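(* Let $(M,\Pi)$ be an oriented $2$-dimensional Poisson manifold and $\alpha\in C^\infty(M)$. Let $\nu\in\Omega^2(M)$ be a fixed volume form, and put $f=\imath_\Pi\nu\in C^\infty(M)$ and $\theta=d\alpha$. Then the cohomologies $H^\bullet_{LP,\alpha}(M,\Pi)$ and $H^\bullet_{f,\theta}(M)$ are isomorphic.
   Context: $\mathcal{V}^p(M)$ denotes the space of smooth $p$-vector fields on $M$ and $\Omega^p(M)$ the space of smooth $p$-forms. A Poisson structure is $\Pi\in\mathcal{V}^2(M)$ with vanishing Schouten--Nijenhuis bracket $[\Pi,\Pi]_{SN}=0$ (automatic in dimension $2$). The Lichnerowicz--Poisson differential is $d_\Pi:\mathcal{V}^p(M)\to\mathcal{V}^{p+1}(M)$, $d_\Pi(X)=[X,\Pi]_{SN}$, with the sign convention for which $d_\Pi$ is a graded derivation of degree $1$ of the wedge product; in dimension $2$ this means $d_\Pi(g)=X_g:=\Pi(dg,\cdot)$ (the Hamiltonian vector field of $g$) for $g\in C^\infty(M)$, $d_\Pi(X)=\mathcal{L}_X\Pi$ for $X\in\mathcal{V}^1(M)$, and $d_\Pi=0$ on $\mathcal{V}^2(M)$. The twisted differential is $d_{\Pi,\alpha}(X)=d_\Pi(X)-X_\alpha\wedge X$ for $X\in\mathcal{V}^p(M)$, $p=0,1,2$, and $H^\bullet_{LP,\alpha}(M,\Pi)$ is the cohomology of $(\mathcal{V}^\bullet(M),d_{\Pi,\alpha})$. Contraction of bivectors: $\imath_{X\wedge Y}\nu=\nu(X,Y)$. For $f\in C^\infty(M)$,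 a closed $1$-form $\theta$, and $\varphi\in\Omega^r(M)$, put $d_f\varphi=f\,d\varphi-r\,df\wedge\varphi$ and $d_{f,\theta}\varphi=d_f\varphi-f\theta\wedge\varphi$. Then $d_{f,\theta}^2=0$, and $H^\bullet_{f,\theta}(M)$ is the cohomology of $(\Omega^\bullet(M),d_{f,\theta})$ (written $H^\bullet_{f,\theta}(M,\Pi)$ in this Poisson setting). *)

theory Defs
  imports "HOL-Analysis.Analysis" "HOL-Library.Function_Algebras"
begin

section \<open>Function spaces and quotient spaces\<close>

instantiation "fun" :: (type, real_vector) real_vector
begin

definition "scaleR r f = (\<lambda>x. r *\<^sub>R f x)"

instance
  by standard (simp_all add: scaleR_fun_def fun_eq_iff scaleR_add_right scaleR_add_left)

end

definition coset :: "'a::real_vector set \<Rightarrow> 'a \<Rightarrow> 'a set" where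
  "coset B x = (\<lambda>b. x + b) ` B"

definition coset_add :: "'a::real_vector set \<Rightarrow> 'a set \<Rightarrow> 'a set" where
  "coset_add S T = {x + y | x y. x \<in> S \<and> y \<in> T}"

text \<open>The summand \<open>b\<close> makes \<open>0 \<cdot> S\<close> equal to \<open>B\<close> rather than \<open>{0}\<close>.\<close>

definition coset_scale :: "'a::real_vector set \<Rightarrow> real \<Rightarrow> 'a set \<Rightarrow> 'a set" where
  "coset_scale B r S = {r *\<^sub>R x + b | x b. x \<in> S \<and> b \<in> B}"

definition quotient_space :: "'a::real_vector set \<Rightarrow> 'a set \<Rightarrow> 'a set set" where
  "quotient_space Z B = coset B ` Z"

definition quotient_isomorphic ::
    "'a::real_vector set \<Rightarrow> 'a set \<Rightarrow> 'b::real_vector set \<Rightarrow> 'b set \<Rightarrow> bool" where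
  "quotient_isomorphic Z B Z' B' \<longleftrightarrow>
     (\<exists>T. bij_betw T (quotient_space Z B) (quotient_space Z' B') \<and>
          (\<forall>S \<in> quotient_space Z B. \<forall>S' \<in> quotient_space Z B.
             T (coset_add S S') = coset_add (T S) (T S')) \<and>
          (\<forall>r. \<forall>S \<in> quotient_space Z B. T (coset_scale B r S) = coset_scale B' r (T S)))"

text \<open>A sequence of spaces \<open>C p\<close> with maps \<open>d p\<close> from \<open>C p\<close> to \<open>C (p + 1)\<close>.\<close>

definition cocycles ::
    "(nat \<Rightarrow> 'a::real_vector set) \<Rightarrow> (nat \<Rightarrow> 'a \<Rightarrow> 'a) \<Rightarrow> nat \<Rightarrow> 'a set" where
  "cocycles C d p = {x \<in> C p. d p x = 0}"

definition coboundaries ::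
    "(nat \<Rightarrow> 'a::real_vector set) \<Rightarrow> (nat \<Rightarrow> 'a \<Rightarrow> 'a) \<Rightarrow> nat \<Rightarrow> 'a set" where
  "coboundaries C d p = (case p of 0 \<Rightarrow> {0} | Suc q \<Rightarrow> d q ` C q)"

definition cohomology_isomorphic ::
    "(nat \<Rightarrow> 'a::real_vector set) \<Rightarrow> (nat \<Rightarrow> 'a \<Rightarrow> 'a) \<Rightarrow>
     (nat \<Rightarrow> 'b::real_vector set) \<Rightarrow> (nat \<Rightarrow> 'b \<Rightarrow> 'b) \<Rightarrow> bool" where
  "cohomology_isomorphic C d C' d' \<longleftrightarrow>
     (\<forall>p. quotient_isomorphic (cocycles C d p) (coboundaries C d p)
                              (cocycles C' d' p) (coboundaries C' d' p))"


section \<open>Smooth maps and smooth manifolds\<close>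

text \<open>\<open>C\<^sup>k\<close> on an open set: \<open>C\<^sup>k\<^sup>+\<^sup>1\<close> means differentiable with all directional derivatives \<open>C\<^sup>k\<close>.\<close>

primrec Ck_on :: "nat \<Rightarrow> 'a::euclidean_space set \<Rightarrow> ('a \<Rightarrow> 'b::real_normed_vector) \<Rightarrow> bool" where
  "Ck_on 0 S f \<longleftrightarrow> continuous_on S f"
| "Ck_on (Suc k) S f \<longleftrightarrow>
     (\<forall>x\<in>S. f differentiable (at x)) \<and>
     (\<forall>v. Ck_on k S (\<lambda>x. frechet_derivative f (at x) v))"

definition smooth_on :: "'a::euclidean_space set \<Rightarrow> ('a \<Rightarrow> 'b::real_normed_vector) \<Rightarrow> bool" where
  "smooth_on S f \<longleftrightarrow> (\<forall>k. Ck_on k S f)"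

text \<open>A chart is an open set of the manifold together with a coordinate map on it; the values of
  the coordinate map outside that set are irrelevant.\<close>

type_synonym ('m, 'n) chart = "'m set \<times> ('m \<Rightarrow> real^'n)"

definition chart_image :: "('m, 'n::finite) chart \<Rightarrow> (real^'n) set" where
  "chart_image c = snd c ` fst c"

definition chart_inv :: "('m, 'n::finite) chart \<Rightarrow> real^'n \<Rightarrow> 'm" where
  "chart_inv c = inv_into (fst c) (snd c)"

definition is_chart :: "'m topology \<Rightarrow> ('m, 'n::finite) chart \<Rightarrow> bool" where
  "is_chart X c \<longleftrightarrow> openin X (fst c) \<and> open (chart_image c) \<and>
     homeomorphic_map (subtopology X (fst c)) (top_of_set (chart_image c)) (snd c)"

definition overlap :: "('m, 'n::finite) chart \<Rightarrow> ('m, 'n) chart \<Rightarrow> (real^'n) set" where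
  "overlap c c' = snd c ` (fst c \<inter> fst c')"

definition transition :: "('m, 'n::finite) chart \<Rightarrow> ('m, 'n) chart \<Rightarrow> real^'n \<Rightarrow> real^'n" where
  "transition c c' = snd c' \<circ> chart_inv c"

definition transition_deriv ::
    "('m, 'n::finite) chart \<Rightarrow> ('m, 'n) chart \<Rightarrow> real^'n \<Rightarrow> real^'n \<Rightarrow> real^'n" where
  "transition_deriv c c' x = frechet_derivative (transition c c') (at x)"

definition smooth_atlas :: "'m topology \<Rightarrow> ('m, 'n::finite) chart set \<Rightarrow> bool" where
  "smooth_atlas X A \<longleftrightarrow> (\<forall>c\<in>A. is_chart X c) \<and> topspace X = (\<Union>c\<in>A. fst c) \<and>
     (\<forall>c\<in>A. \<forall>c'\<in>A. smooth_on (overlap c c') (transition c c'))"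

definition smooth_manifold :: "'m topology \<Rightarrow> ('m, 'n::finite) chart set \<Rightarrow> bool" where
  "smooth_manifold X A \<longleftrightarrow> Hausdorff_space X \<and>
     second_countable X \<and> smooth_atlas X A"

text \<open>An orientation is given by an atlas whose coordinate changes all preserve the orientation
  of \<open>\<real>\<^sup>n\<close>.\<close>

definition oriented_manifold :: "'m topology \<Rightarrow> ('m, 'n::finite) chart set \<Rightarrow> bool" where
  "oriented_manifold X A \<longleftrightarrow> smooth_manifold X A \<and>
     (\<forall>c\<in>A. \<forall>c'\<in>A. \<forall>x\<in>overlap c c'. det (matrix (transition_deriv c c' x)) > 0)"

definition smooth_function :: "('m, 'n::finite) chart set \<Rightarrow> ('m \<Rightarrow> real) \<Rightarrow> bool" where
  "smooth_function A g \<longleftrightarrow> (\<forall>c\<in>A. smooth_on (chart_image c) (g \<circ> chart_inv c))"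


section \<open>Alternating multilinear forms\<close>

text \<open>An alternating \<open>r\<close>-linear form is a function on lists, equal to \<open>0\<close> on lists of length
  other than \<open>r\<close>.\<close>

definition alternating_form :: "nat \<Rightarrow> ('v::real_vector list \<Rightarrow> real) \<Rightarrow> bool" where
  "alternating_form r \<phi> \<longleftrightarrow>
     (\<forall>vs. length vs \<noteq> r \<longrightarrow> \<phi> vs = 0) \<and>
     (\<forall>vs i. length vs = r \<and> i < r \<longrightarrow> linear (\<lambda>v. \<phi> (vs[i := v]))) \<and>
     (\<forall>vs i j. length vs = r \<and> i < j \<and> j < r \<and> vs ! i = vs ! j \<longrightarrow> \<phi> vs = 0)"

text \<open>Wedge product of an \<open>r\<close>-form and an \<open>s\<close>-form, normalised by
  \<open>(\<phi> \<and> \<psi>)(v, w) = \<phi>(v) \<psi>(w) - \<phi>(w) \<psi>(v)\<close> for \<open>r = s = 1\<close>.\<close>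

definition wedge ::
    "nat \<Rightarrow> nat \<Rightarrow> ('v list \<Rightarrow> real) \<Rightarrow> ('v list \<Rightarrow> real) \<Rightarrow> 'v list \<Rightarrow> real" where
  "wedge r s \<phi> \<psi> vs =
     (if length vs = r + s then
        (\<Sum>\<sigma> | \<sigma> permutes {..<r + s}. of_int (sign \<sigma>) *
           \<phi> (map (\<lambda>i. vs ! \<sigma> i) [0..<r]) * \<psi> (map (\<lambda>i. vs ! \<sigma> i) [r..<r + s]))
        / (fact r * fact s)
      else 0)"


section \<open>Differential forms and multivector fields\<close>

text \<open>A differential form is a family of forms on the images of the charts of the atlas which
  agree under pullback along the coordinate changes; a multivector field is such a family which
  agrees under pushforward. A \<open>p\<close>-vector at a point is an alternating \<open>p\<close>-linear form on
  covectors. To make the families unique they vanish outside the chart images. Smooth functions on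
  the manifold are the fields of degree \<open>0\<close>, with value at the empty list.\<close>

type_synonym ('m, 'n, 'v) field = "('m, 'n) chart \<Rightarrow> real^'n \<Rightarrow> 'v list \<Rightarrow> real"
type_synonym ('m, 'n) form = "('m, 'n, real^'n) field"
type_synonym ('m, 'n) mvec = "('m, 'n, (real^'n) \<Rightarrow>\<^sub>L real) field"

definition smooth_field ::
    "('m, 'n::finite) chart set \<Rightarrow> nat \<Rightarrow> ('m, 'n, 'v::real_vector) field \<Rightarrow> bool" where
  "smooth_field A r F \<longleftrightarrow>
     (\<forall>c\<in>A. \<forall>x\<in>chart_image c. alternating_form r (F c x)) \<and>
     (\<forall>c\<in>A. \<forall>vs. smooth_on (chart_image c) (\<lambda>x. F c x vs)) \<and>
     (\<forall>c x. \<not> (c \<in> A \<and> x \<in> chart_image c) \<longrightarrow> F c x = 0)"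

definition Forms :: "('m, 'n::finite) chart set \<Rightarrow> nat \<Rightarrow> ('m, 'n) form set" where
  "Forms A r = {\<omega>. smooth_field A r \<omega> \<and>
     (\<forall>c\<in>A. \<forall>c'\<in>A. \<forall>x\<in>overlap c c'. \<forall>vs.
        \<omega> c x vs = \<omega> c' (transition c c' x) (map (transition_deriv c c' x) vs))}"

definition MVecs :: "('m, 'n::finite) chart set \<Rightarrow> nat \<Rightarrow> ('m, 'n) mvec set" where
  "MVecs A p = {P. smooth_field A p P \<and>
     (\<forall>c\<in>A. \<forall>c'\<in>A. \<forall>x\<in>overlap c c'. \<forall>\<xi>s.
        P c' (transition c c' x) \<xi>s = P c x (map (\<lambda>\<xi>. \<xi> o\<^sub>L Blinfun (transition_deriv c c' x)) \<xi>s))}"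

definition on_charts ::
    "('m, 'n::finite) chart set \<Rightarrow> ('m, 'n, 'v) field \<Rightarrow> ('m, 'n, 'v) field" where
  "on_charts A F = (\<lambda>c x. if c \<in> A \<and> x \<in> chart_image c then F c x else 0)"

definition scalar_field ::
    "('m, 'n::finite) chart set \<Rightarrow> ('m \<Rightarrow> real) \<Rightarrow> ('m, 'n, 'v) field" where
  "scalar_field A g = on_charts A (\<lambda>c x vs. if vs = [] then g (chart_inv c x) else 0)"

definition volume_form :: "('m, 'n::finite) chart set \<Rightarrow> ('m, 'n) form \<Rightarrow> bool" where
  "volume_form A \<nu> \<longleftrightarrow> \<nu> \<in> Forms A CARD('n) \<and> (\<forall>c\<in>A. \<forall>x\<in>chart_image c. \<nu> c x \<noteq> 0)"

definition coord_covector :: "'n \<Rightarrow> (real^'n::finite) \<Rightarrow>\<^sub>L real" where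
  "coord_covector i = Blinfun (\<lambda>v. v $ i)"

text \<open>The linear extension of \<open>\<iota>(X \<and> Y) \<nu> = \<nu>(X, Y)\<close>: a bivector \<open>\<pi>\<close> is
  \<open>\<Sum>i j. \<pi>(dx\<^sub>i, dx\<^sub>j)/2 \<partial>\<^sub>i \<and> \<partial>\<^sub>j\<close>.\<close>

definition bivector_contract ::
    "('m, 'n::finite) chart set \<Rightarrow> ('m, 'n) mvec \<Rightarrow> ('m, 'n) form \<Rightarrow> ('m, 'n) form" where
  "bivector_contract A \<pi> \<nu> = on_charts A (\<lambda>c x vs. if vs = [] then
     (\<Sum>i\<in>UNIV. \<Sum>j\<in>UNIV. \<pi> c x [coord_covector i, coord_covector j] *
        \<nu> c x [axis i 1, axis j 1]) / 2 else 0)"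


section \<open>The de Rham type differentials\<close>

text \<open>In coordinates, \<open>d\<omega>(v\<^sub>0, \<dots>, v\<^sub>r)\<close> is the alternating sum of the derivatives in direction
  \<open>v\<^sub>i\<close> of \<open>\<omega>\<close> applied to the other (constant) vectors.\<close>

definition ext_deriv ::
    "('m, 'n::finite) chart set \<Rightarrow> nat \<Rightarrow> ('m, 'n) form \<Rightarrow> ('m, 'n) form" where
  "ext_deriv A r \<omega> = on_charts A (\<lambda>c x vs. if length vs = Suc r then
     (\<Sum>i<Suc r. (-1) ^ i *
        frechet_derivative (\<lambda>y. \<omega> c y (take i vs @ drop (Suc i) vs)) (at x) (vs ! i)) else 0)"

definition d_f ::
    "('m, 'n::finite) chart set \<Rightarrow> ('m, 'n) form \<Rightarrow> nat \<Rightarrow> ('m, 'n) form \<Rightarrow> ('m, 'n) form" where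
  "d_f A f r \<phi> = on_charts A (\<lambda>c x vs.
     f c x [] * ext_deriv A r \<phi> c x vs - of_nat r * wedge 1 r (ext_deriv A 0 f c x) (\<phi> c x) vs)"

definition d_f_theta ::
    "('m, 'n::finite) chart set \<Rightarrow> ('m, 'n) form \<Rightarrow> ('m, 'n) form \<Rightarrow> nat \<Rightarrow> ('m, 'n) form \<Rightarrow> ('m, 'n) form" where
  "d_f_theta A f \<theta> r \<phi> = on_charts A (\<lambda>c x vs.
     d_f A f r \<phi> c x vs - f c x [] * wedge 1 r (\<theta> c x) (\<phi> c x) vs)"


section \<open>The Lichnerowicz--Poisson differentials\<close>

definition partial_mvec ::
    "'n::finite \<Rightarrow> ('m, 'n) mvec \<Rightarrow> ('m, 'n) mvec" where
  "partial_mvec i P c x \<xi>s = frechet_derivative (\<lambda>y. P c y \<xi>s) (at x) (axis i 1)"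

text \<open>Contraction with a covector in the last slot; it is \<open>0\<close> on fields of degree \<open>0\<close>.\<close>

definition contract_last ::
    "('v list \<Rightarrow> real) \<Rightarrow> 'v \<Rightarrow> 'v list \<Rightarrow> real" where
  "contract_last P \<xi> = (\<lambda>\<eta>s. P (\<eta>s @ [\<xi>]))"

text \<open>The coordinate expression of the Schouten--Nijenhuis bracket of a \<open>p\<close>-vector and a
  \<open>q\<close>-vector field. It extends the Lie bracket of vector fields, and the overall sign (the bracket
  of \<open>P\<close> and \<open>Q\<close> here is minus the bracket of \<open>Q\<close> and \<open>P\<close> in the other common convention) is
  such that bracketing with a bivector field \<open>\<pi>\<close> on the right is a derivation of degree \<open>1\<close> of
  the wedge product: \<open>[g, \<pi>] = \<pi>(dg, \<cdot>)\<close> for functions and \<open>[X, \<pi>]\<close> is the Lie derivative of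
  \<open>\<pi>\<close> for vector fields. The exponent \<open>(p + 1) (q + 1)\<close> has the parity of \<open>(p - 1) (q - 1)\<close>;
  for \<open>p = 0\<close> or \<open>q = 0\<close> the term with the truncated subtraction vanishes.\<close>

definition schouten ::
    "('m, 'n::finite) chart set \<Rightarrow> nat \<Rightarrow> nat \<Rightarrow> ('m, 'n) mvec \<Rightarrow> ('m, 'n) mvec \<Rightarrow> ('m, 'n) mvec" where
  "schouten A p q P Q = on_charts A (\<lambda>c x \<xi>s. \<Sum>i\<in>UNIV.
     (-1) ^ ((p + 1) * (q + 1)) *
       wedge (p - 1) q (contract_last (P c x) (coord_covector i)) (partial_mvec i Q c x) \<xi>s
     - wedge (q - 1) p (contract_last (Q c x) (coord_covector i)) (partial_mvec i P c x) \<xi>s)"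

definition poisson_structure :: "('m, 'n::finite) chart set \<Rightarrow> ('m, 'n) mvec \<Rightarrow> bool" where
  "poisson_structure A \<pi> \<longleftrightarrow> \<pi> \<in> MVecs A 2 \<and> schouten A 2 2 \<pi> \<pi> = 0"

definition d_Pi ::
    "('m, 'n::finite) chart set \<Rightarrow> ('m, 'n) mvec \<Rightarrow> nat \<Rightarrow> ('m, 'n) mvec \<Rightarrow> ('m, 'n) mvec" where
  "d_Pi A \<pi> p X = schouten A p 2 X \<pi>"

definition hamiltonian_field ::
    "('m, 'n::finite) chart set \<Rightarrow> ('m, 'n) mvec \<Rightarrow> ('m \<Rightarrow> real) \<Rightarrow> ('m, 'n) mvec" where
  "hamiltonian_field A \<pi> g = on_charts A (\<lambda>c x \<eta>s.
     \<pi> c x (Blinfun (frechet_derivative (g \<circ> chart_inv c) (at x)) # \<eta>s))"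

definition d_Pi_alpha ::
    "('m, 'n::finite) chart set \<Rightarrow> ('m, 'n) mvec \<Rightarrow> ('m \<Rightarrow> real) \<Rightarrow> nat \<Rightarrow> ('m, 'n) mvec \<Rightarrow> ('m, 'n) mvec" where
  "d_Pi_alpha A \<pi> \<alpha> p X = on_charts A (\<lambda>c x \<xi>s.
     d_Pi A \<pi> p X c x \<xi>s - wedge 1 p (hamiltonian_field A \<pi> \<alpha> c x) (X c x) \<xi>s)"

end

theory Submission
  imports Defs
begin

text \<open>
  The volume form identifies tangent vectors with covectors by \<open>v \<mapsto> \<nu>(v, \<cdot>)\<close>, and hence \<open>p\<close>-vectors with
  \<open>p\<close>-forms by \<open>(\<Phi>P)(v\<^sub>1, \<dots>, v\<^sub>p) = P(\<nu>(v\<^sub>1, \<cdot>), \<dots>, \<nu>(v\<^sub>p, \<cdot>))\<close>. This preserves the degree, and it is a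
  chain isomorphism without any signs. With \<open>\<pi> = b \<partial>\<^sub>1 \<and> \<partial>\<^sub>2\<close> and \<open>\<nu> = n dx\<^sub>1 \<and> dx\<^sub>2\<close> we have \<open>f = b n\<close>, and in
  degree \<open>1\<close> both ways around the square give
  \<open>n\<^sup>2 (X(b) - b div X + b X(\<alpha>)) dx\<^sub>1 \<and> dx\<^sub>2\<close>. In degree \<open>2\<close> both differentials vanish, and above it both
  complexes do. As \<open>\<Phi>\<close> is injective on all families of multivectors on the chart images, smooth and
  compatible with the coordinate changes or not, there is no need to know that \<open>d\<^sub>\<Pi>\<^sub>,\<^sub>\<alpha>\<close> produces multivector fields.
\<close>

section \<open>Calculus of smooth functions\<close>

text \<open>On an open set the derivative at a point depends only on the values nearby, so agreement
  on \<open>S\<close> passes to all directional derivatives and the induction runs on those.\<close>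

lemma Ck_on_cong:
  assumes "open S" "Ck_on k S f" "\<And>x. x \<in> S \<Longrightarrow> f x = g x"
  shows "Ck_on k S g"
  using assms(2,3)
proof (induction k arbitrary: f g)
  case 0
  then show ?case by (simp cong: continuous_on_cong)
next
  case (Suc k)
  have "g differentiable at x" if "x \<in> S" for x
    using Suc.prems that assms(1)
    by (meson Ck_on.simps(2) differentiable_def has_derivative_transform_within_open)
  moreover have "Ck_on k S (\<lambda>x. frechet_derivative g (at x) v)" for v
  proof (rule Suc.IH)
    show "Ck_on k S (\<lambda>x. frechet_derivative f (at x) v)"
      using Suc.prems(1) by simp
    show "frechet_derivative f (at x) v = frechet_derivative g (at x) v" if "x \<in> S" for x
      using Suc.prems that frechet_derivative_transform_within_open[of f x S g] assms(1) by simp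
  qed
  ultimately show ?case by simp
qed

text \<open>The base case is that differentiability implies continuity; the step applies the
  induction hypothesis to the directional derivatives.\<close>

lemma Ck_on_SucD: "Ck_on (Suc k) S f \<Longrightarrow> Ck_on k S f"
proof (induction k arbitrary: f)
  case 0
  then show ?case
    by (auto intro!: continuous_at_imp_continuous_on differentiable_imp_continuous_within)
next
  case (Suc k)
  then have "Ck_on k S (\<lambda>x. frechet_derivative f (at x) v)" for v
    using Ck_on.simps(2) by blast
  with Suc.prems show ?case by simp
qed

lemma Ck_on_const: "Ck_on k S (\<lambda>x. c)"
  by (induction k arbitrary: c) auto

lemma Ck_on_add:
  assumes "open S" "Ck_on k S f" "Ck_on k S g"
  shows "Ck_on k S (\<lambda>x. f x + g x)"
  using assms(2,3)
proof (induction k arbitrary: f g)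
  case 0
  then show ?case by (auto intro: continuous_on_add)
next
  case (Suc k)
  have der: "((\<lambda>x. f x + g x) has_derivative
      (\<lambda>v. frechet_derivative f (at x) v + frechet_derivative g (at x) v)) (at x)" if "x \<in> S" for x
    using Suc.prems that by (intro has_derivative_add) (simp_all flip: frechet_derivative_works)
  have "Ck_on k S (\<lambda>x. frechet_derivative f (at x) v + frechet_derivative g (at x) v)" for v
    using Suc.prems by (intro Suc.IH) simp_all
  then have "Ck_on k S (\<lambda>x. frechet_derivative (\<lambda>x. f x + g x) (at x) v)" for v
    by (rule Ck_on_cong[OF assms(1)]) (simp flip: frechet_derivative_at[OF der])
  then show ?case
    using der by (auto simp: differentiable_def)
qed

lemma has_derivative_mult_real:
  fixes f g :: "'a::real_normed_vector \<Rightarrow> real"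
  assumes "f differentiable at x" "g differentiable at x"
  shows "((\<lambda>x. f x * g x) has_derivative
    (\<lambda>v. f x * frechet_derivative g (at x) v + frechet_derivative f (at x) v * g x)) (at x)"
  using assms unfolding frechet_derivative_works by (rule has_derivative_mult)

text \<open>By the Leibniz rule the derivative is a sum of products of functions that are again
  \<open>Ck_on k\<close>; for the undifferentiated factors this is
  \<open>Ck_on_SucD\<close>.\<close>

lemma Ck_on_mult:
  fixes f g :: "'a::euclidean_space \<Rightarrow> real"
  assumes "open S" "Ck_on k S f" "Ck_on k S g"
  shows "Ck_on k S (\<lambda>x. f x * g x)"
  using assms(2,3)
proof (induction k arbitrary: f g)
  case 0
  then show ?case by (auto intro: continuous_on_mult)
next
  case (Suc k)
  have eq: "f x * frechet_derivative g (at x) v + frechet_derivative f (at x) v * g x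
      = frechet_derivative (\<lambda>x. f x * g x) (at x) v" if "x \<in> S" for x v
    using Suc.prems that
    by (auto intro!: fun_cong[OF frechet_derivative_at[OF has_derivative_mult_real]])
  have "Ck_on k S (\<lambda>x. f x * frechet_derivative g (at x) v + frechet_derivative f (at x) v * g x)" for v
    using Suc.prems Ck_on_SucD[OF Suc.prems(1)] Ck_on_SucD[OF Suc.prems(2)]
    by (intro Ck_on_add[OF assms(1)] Suc.IH) simp_all
  then have "Ck_on k S (\<lambda>x. frechet_derivative (\<lambda>x. f x * g x) (at x) v)" for v
    by (rule Ck_on_cong[OF assms(1) _ eq])
  then show ?case
    using Suc.prems by (auto intro: differentiable_mult)
qed

text \<open>The derivative of \<open>1/f\<close> is \<open>-(1/f) * Df * (1/f)\<close>. The
  induction hypothesis, for the same \<open>f\<close>, makes \<open>1/f\<close> itself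
  \<open>Ck_on k\<close>, and then the product does the rest.\<close>

lemma Ck_on_inverse:
  fixes f :: "'a::euclidean_space \<Rightarrow> real"
  assumes "open S" "Ck_on k S f" "\<And>x. x \<in> S \<Longrightarrow> f x \<noteq> 0"
  shows "Ck_on k S (\<lambda>x. inverse (f x))"
  using assms(2)
proof (induction k)
  case 0
  then show ?case using assms(3) by (auto intro: continuous_on_inverse)
next
  case (Suc k)
  have inv: "Ck_on k S (\<lambda>x. inverse (f x))"
    using Suc Ck_on_SucD by blast
  have der: "((\<lambda>x. inverse (f x)) has_derivative
      (\<lambda>v. - (inverse (f x) * frechet_derivative f (at x) v * inverse (f x)))) (at x)" if "x \<in> S" for x
    using Suc.prems that assms(3) by (intro Deriv.has_derivative_inverse) (auto simp: frechet_derivative_works)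
  have eq: "(-1) * (inverse (f x) * frechet_derivative f (at x) v * inverse (f x))
      = frechet_derivative (\<lambda>x. inverse (f x)) (at x) v" if "x \<in> S" for x v
    using fun_cong[OF frechet_derivative_at[OF der[OF that]], of v] by simp
  have "Ck_on k S (\<lambda>x. (-1) * (inverse (f x) * frechet_derivative f (at x) v * inverse (f x)))" for v
    using Suc.prems by (intro Ck_on_mult[OF assms(1)] Ck_on_const inv) auto
  then have "Ck_on k S (\<lambda>x. frechet_derivative (\<lambda>x. inverse (f x)) (at x) v)" for v
    by (rule Ck_on_cong[OF assms(1) _ eq])
  then show ?case
    using der by (auto simp: differentiable_def)
qed

lemma smooth_on_cong:
  "open S \<Longrightarrow> smooth_on S f \<Longrightarrow> (\<And>x. x \<in> S \<Longrightarrow> f x = g x) \<Longrightarrow> smooth_on S g"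
  unfolding smooth_on_def by (blast intro: Ck_on_cong)

lemma smooth_on_const: "smooth_on S (\<lambda>x. c)"
  by (simp add: smooth_on_def Ck_on_const)

lemma smooth_on_add:
  "open S \<Longrightarrow> smooth_on S f \<Longrightarrow> smooth_on S g \<Longrightarrow> smooth_on S (\<lambda>x. f x + g x)"
  by (simp add: smooth_on_def Ck_on_add)

lemma smooth_on_mult:
  fixes f g :: "'a::euclidean_space \<Rightarrow> real"
  shows "open S \<Longrightarrow> smooth_on S f \<Longrightarrow> smooth_on S g \<Longrightarrow> smooth_on S (\<lambda>x. f x * g x)"
  by (simp add: smooth_on_def Ck_on_mult)

lemma smooth_on_diff:
  fixes f g :: "'a::euclidean_space \<Rightarrow> real"
  assumes "open S" "smooth_on S f" "smooth_on S g"
  shows "smooth_on S (\<lambda>x. f x - g x)"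
  using smooth_on_add[OF assms(1,2) smooth_on_mult[OF assms(1) smooth_on_const[of S "-1"] assms(3)]]
  by simp

lemma smooth_on_inverse:
  fixes f :: "'a::euclidean_space \<Rightarrow> real"
  shows "open S \<Longrightarrow> smooth_on S f \<Longrightarrow> (\<And>x. x \<in> S \<Longrightarrow> f x \<noteq> 0) \<Longrightarrow> smooth_on S (\<lambda>x. inverse (f x))"
  by (simp add: smooth_on_def Ck_on_inverse)

lemma smooth_on_differentiable: "smooth_on S f \<Longrightarrow> x \<in> S \<Longrightarrow> f differentiable at x"
  unfolding smooth_on_def by (metis Ck_on.simps(2))


section \<open>Alternating forms on a plane\<close>

lemma alternating_form_length: "alternating_form r \<phi> \<Longrightarrow> length vs \<noteq> r \<Longrightarrow> \<phi> vs = 0"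
  by (simp add: alternating_form_def)

lemma alternating_form_linear:
  "alternating_form r \<phi> \<Longrightarrow> length vs = r \<Longrightarrow> i < r \<Longrightarrow> linear (\<lambda>v. \<phi> (vs[i := v]))"
  by (simp add: alternating_form_def)

lemma alternating_form_eq_zero:
  "alternating_form r \<phi> \<Longrightarrow> length vs = r \<Longrightarrow> i < j \<Longrightarrow> j < r \<Longrightarrow> vs ! i = vs ! j \<Longrightarrow> \<phi> vs = 0"
  unfolding alternating_form_def by blast

lemma alternating_form_zero: "alternating_form r 0"
  by (simp add: alternating_form_def linear_iff)

lemma alternating_form_map:
  fixes L :: "'a::real_vector \<Rightarrow> 'b::real_vector"
  assumes "alternating_form r \<phi>" "linear L"
  shows "alternating_form r (\<lambda>ws. \<phi> (map L ws))"
  unfolding alternating_form_def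
proof (intro conjI allI impI)
  fix ws :: "'a list" and i assume "length ws = r \<and> i < r"
  then show "linear (\<lambda>v. \<phi> (map L (ws[i := v])))"
    using linear_compose[OF assms(2) alternating_form_linear[OF assms(1), of "map L ws" i]]
    by (simp add: map_update o_def)
next
  fix ws :: "'a list" and i j assume "length ws = r \<and> i < j \<and> j < r \<and> ws ! i = ws ! j"
  then show "\<phi> (map L ws) = 0"
    by (intro alternating_form_eq_zero[OF assms(1), of _ i j]) auto
qed (simp add: alternating_form_length[OF assms(1)])

text \<open>Stated for an abstract pair so that the same lemmas serve vectors, with the standard
  basis, and covectors, with the dual basis.\<close>

definition spans_plane :: "'v::real_vector \<Rightarrow> 'v \<Rightarrow> bool" where
  "spans_plane a b \<longleftrightarrow> (\<forall>v. \<exists>s t. v = s *\<^sub>R a + t *\<^sub>R b)"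

lemma alternating_form_one_linear:
  assumes "alternating_form 1 \<phi>"
  shows "linear (\<lambda>v. \<phi> [v])"
  \<comment> \<open>The entry \<open>undefined\<close> is overwritten by the update at position 0;
    only the length of the list matters.\<close>
  using alternating_form_linear[OF assms, of "[undefined]" 0] by simp

lemma alternating_form_one:
  assumes "alternating_form 1 \<phi>"
  shows "\<phi> [s *\<^sub>R a + t *\<^sub>R b] = s * \<phi> [a] + t * \<phi> [b]"
  using alternating_form_one_linear[OF assms]
  by (simp add: linear_add[of "\<lambda>v. \<phi> [v]"] linear_scale[of "\<lambda>v. \<phi> [v]"])

lemma alternating_form_two_linear:
  assumes "alternating_form 2 \<phi>"
  shows "linear (\<lambda>v. \<phi> [v, w])" "linear (\<lambda>v. \<phi> [w, v])"
  using alternating_form_linear[OF assms, of "[undefined, w]" 0]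
    alternating_form_linear[OF assms, of "[w, undefined]" 1] by simp_all

lemma alternating_form_two_self:
  assumes "alternating_form 2 \<phi>"
  shows "\<phi> [v, v] = 0"
  using alternating_form_eq_zero[OF assms, of "[v, v]" 0 1] by simp

text \<open>Polarization: expand \<open>\<phi> [v + w, v + w] = 0\<close> bilinearly.\<close>

lemma alternating_form_two_swap:
  assumes "alternating_form 2 \<phi>"
  shows "\<phi> [w, v] = - \<phi> [v, w]"
proof -
  have "\<phi> [v + w, v + w] = \<phi> [v, v] + \<phi> [v, w] + \<phi> [w, v] + \<phi> [w, w]"
    by (simp only: linear_add[OF alternating_form_two_linear(1)[OF assms]]
        linear_add[OF alternating_form_two_linear(2)[OF assms]])
  then have "\<phi> [v, w] + \<phi> [w, v] = 0"
    by (simp add: alternating_form_two_self[OF assms])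
  then show ?thesis by linarith
qed

lemma alternating_form_two:
  assumes "alternating_form 2 \<phi>"
  shows "\<phi> [s *\<^sub>R a + t *\<^sub>R b, s' *\<^sub>R a + t' *\<^sub>R b] = (s * t' - t * s') * \<phi> [a, b]"
  by (simp add: alternating_form_two_self[OF assms] alternating_form_two_swap[OF assms, of b a]
      linear_add[OF alternating_form_two_linear(1)[OF assms]]
      linear_add[OF alternating_form_two_linear(2)[OF assms]]
      linear_scale[OF alternating_form_two_linear(1)[OF assms]]
      linear_scale[OF alternating_form_two_linear(2)[OF assms]] algebra_simps)

text \<open>By linearity in one slot, a nonzero value stays nonzero for a suitable replacement of
  that entry by \<open>a\<close> or \<open>b\<close>. After three replacements two of the new
  entries coincide, which contradicts alternation.\<close>

lemma alternating_form_plane_eq_zero: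
  fixes a b :: "'v::real_vector" and \<phi> :: "'v list \<Rightarrow> real"
  assumes "spans_plane a b" "alternating_form r \<phi>" "r \<ge> 3"
  shows "\<phi> vs = 0"
proof (rule ccontr)
  assume nz: "\<phi> vs \<noteq> 0"
  have step: "\<exists>e\<in>{a, b}. \<phi> (us[i := e]) \<noteq> 0" if "\<phi> us \<noteq> 0" "i < r" for us :: "'v list" and i
  proof -
    have len: "length us = r"
      using that alternating_form_length[OF assms(2)] by blast
    obtain s t where "us ! i = s *\<^sub>R a + t *\<^sub>R b"
      using assms(1) unfolding spans_plane_def by blast
    then have "us = us[i := s *\<^sub>R a + t *\<^sub>R b]"
      by (metis list_update_id)
    moreover have lin: "linear (\<lambda>v. \<phi> (us[i := v]))"
      using assms(2) len that(2) by (rule alternating_form_linear)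
    ultimately have "\<phi> us = s * \<phi> (us[i := a]) + t * \<phi> (us[i := b])"
      using linear_add[OF lin] linear_scale[OF lin] by (metis real_scaleR_def)
    with that show ?thesis by auto
  qed
  obtain e0 where e0: "e0 \<in> {a, b}" "\<phi> (vs[0 := e0]) \<noteq> 0"
    using step[OF nz, of 0] assms(3) by auto
  obtain e1 where e1: "e1 \<in> {a, b}" "\<phi> (vs[0 := e0, 1 := e1]) \<noteq> 0"
    using step[OF e0(2), of 1] assms(3) by auto
  obtain e2 where e2: "e2 \<in> {a, b}" "\<phi> (vs[0 := e0, 1 := e1, 2 := e2]) \<noteq> 0"
    using step[OF e1(2), of 2] assms(3) by auto
  let ?us = "vs[0 := e0, 1 := e1, 2 := e2]"
  have len: "length ?us = r"
    using e2(2) alternating_form_length[OF assms(2)] by blast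
  have "e0 = e1 \<or> e0 = e2 \<or> e1 = e2"
    using e0(1) e1(1) e2(1) by auto
  then show False
    using e2(2) alternating_form_eq_zero[OF assms(2) len, of 0 1]
      alternating_form_eq_zero[OF assms(2) len, of 0 2]
      alternating_form_eq_zero[OF assms(2) len, of 1 2] len assms(3)
    by auto
qed

text \<open>Smoothness when the arguments also vary with the point, through smooth coefficients in a
  constant frame. Only degrees 0, 1 and 2 give nonzero values, and there the coefficients come out
  by explicit formulas. Used for both \<open>lower\<close> and \<open>raise\<close>.\<close>

lemma smooth_on_alternating_map:
  fixes F :: "'a::euclidean_space \<Rightarrow> 'v::real_vector list \<Rightarrow> real"
  assumes S: "open S" and ab: "spans_plane a b"
    and F: "\<And>x. x \<in> S \<Longrightarrow> alternating_form r (F x)" "\<And>vs. smooth_on S (\<lambda>x. F x vs)"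
    and L: "\<And>x w. x \<in> S \<Longrightarrow> L x w = s w x *\<^sub>R a + t w x *\<^sub>R b"
    and st: "\<And>w. smooth_on S (s w)" "\<And>w. smooth_on S (t w)"
  shows "smooth_on S (\<lambda>x. F x (map (L x) ws))"
proof -
  consider "length ws \<noteq> r" | "r \<ge> 3" | "ws = []" | w where "r = 1" "ws = [w]"
    | w w' where "r = 2" "ws = [w, w']"
    by (cases "length ws = r"; cases "r \<ge> 3")
      (auto simp: length_Suc_conv less_Suc_eq numeral_3_eq_3 numeral_2_eq_2 not_le)
  then show ?thesis
  proof cases
    case 1
    then show ?thesis
      using alternating_form_length[OF F(1)] by (intro smooth_on_cong[OF S smooth_on_const[of S 0]]) simp
  next
    case 2
    then show ?thesis
      using alternating_form_plane_eq_zero[OF ab F(1)]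
      by (intro smooth_on_cong[OF S smooth_on_const[of S 0]]) simp
  next
    case 3
    then show ?thesis using F(2) by simp
  next
    case 4
    have "smooth_on S (\<lambda>x. s w x * F x [a] + t w x * F x [b])"
      by (intro smooth_on_add smooth_on_mult S F(2) st)
    then show ?thesis
      by (rule smooth_on_cong[OF S]) (use F(1) 4 in \<open>simp add: L alternating_form_one\<close>)
  next
    case 5
    have "smooth_on S (\<lambda>x. (s w x * t w' x - t w x * s w' x) * F x [a, b])"
      by (intro smooth_on_diff smooth_on_mult S F(2) st)
    then show ?thesis
      by (rule smooth_on_cong[OF S]) (use F(1) 5 in \<open>simp add: L alternating_form_two\<close>)
  qed
qed


section \<open>Wedge products in low degree\<close>

lemma sum_permutes_two:
  "(\<Sum>\<sigma> | \<sigma> permutes {..<2::nat}. g \<sigma>) = g id + g (Transposition.transpose 0 1)"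
proof -
  have "{\<sigma>. \<sigma> permutes {..<2::nat}} = {id, Transposition.transpose 0 1}"
    by (auto simp: permutes_doubleton_iff lessThan_Suc numeral_2_eq_2 insert_commute)
  moreover have "Transposition.transpose 0 1 \<noteq> (id :: nat \<Rightarrow> nat)"
    by (metis id_apply transpose_apply_first zero_neq_one)
  ultimately show ?thesis by simp
qed

text \<open>Each permutation of \<open>{0, 1, 2}\<close> is uniquely a transposition of 0 with some
  element (possibly 0 itself) after a permutation of \<open>{1, 2}\<close>.\<close>

lemma sum_permutes_three:
  fixes g :: "(nat \<Rightarrow> nat) \<Rightarrow> real"
  defines "t \<equiv> Transposition.transpose"
  shows "(\<Sum>\<sigma> | \<sigma> permutes {..<3::nat}. g \<sigma>) =
    g id + g (t 1 2) + g (t 0 1) + g (t 0 1 \<circ> t 1 2) + g (t 0 2) + g (t 0 2 \<circ> t 1 2)"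
proof -
  have 1: "{..<3::nat} = insert 0 {1, 2}" by auto
  show ?thesis unfolding 1
    by (simp add: sum_over_permutations_insert t_def)
qed

lemma wedge_length: "length vs \<noteq> r + s \<Longrightarrow> wedge r s \<phi> \<psi> vs = 0"
  by (simp add: wedge_def)

lemma wedge_1_0: "wedge 1 0 \<phi> \<psi> [v] = \<phi> [v] * \<psi> []"
  by (simp add: wedge_def lessThan_Suc)

lemma wedge_1_1: "wedge 1 1 \<phi> \<psi> [v, w] = \<phi> [v] * \<psi> [w] - \<phi> [w] * \<psi> [v]"
proof -
  have "1 + 1 = (2::nat)" by simp
  then show ?thesis
    unfolding wedge_def by (simp add: sum_permutes_two[unfolded numeral_2_eq_2] sign_swap_id)
qed

text \<open>The two permutations contribute equal terms, which cancels the factor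
  \<open>fact 2\<close> in the normalisation.\<close>

lemma wedge_0_2:
  assumes "alternating_form 2 \<psi>"
  shows "wedge 0 2 \<phi> \<psi> [v, w] = \<phi> [] * \<psi> [v, w]"
  by (simp add: wedge_def sum_permutes_two[unfolded numeral_2_eq_2] sign_swap_id upt_rec
      alternating_form_two_swap[OF assms, of w v])

text \<open>The six permutations fall into three pairs of equal terms, one pair for each argument
  given to \<open>\<phi>\<close>; the factor \<open>fact 2\<close> cancels the doubling.\<close>

lemma wedge_1_2:
  assumes "alternating_form 2 \<psi>"
  shows "wedge 1 2 \<phi> \<psi> [u, v, w] = \<phi> [u] * \<psi> [v, w] - \<phi> [v] * \<psi> [u, w] + \<phi> [w] * \<psi> [u, v]"
proof -
  have "1 + 2 = (3::nat)" by simp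
  then show ?thesis
    unfolding wedge_def
    by (simp add: sum_permutes_three[unfolded numeral_3_eq_3 numeral_2_eq_2] sign_swap_id sign_compose
      permutation_swap_id upt_rec
      alternating_form_two_swap[OF assms, of w v] alternating_form_two_swap[OF assms, of v u]
      alternating_form_two_swap[OF assms, of w u])
qed

lemma wedge_zero: "wedge r s 0 \<psi> = 0" "wedge r s \<phi> 0 = 0"
  by (simp_all add: wedge_def fun_eq_iff)

text \<open>A 3-form on a plane vanishes. This is checked by expanding all three arguments in the
  frame, which avoids proving that wedge products are alternating.\<close>

lemma wedge_1_2_plane_eq_zero:
  fixes a b :: "'v::real_vector" and \<phi> \<psi> :: "'v list \<Rightarrow> real"
  assumes "spans_plane a b" "alternating_form 1 \<phi>" "alternating_form 2 \<psi>"
  shows "wedge 1 2 \<phi> \<psi> = 0"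
proof
  fix vs
  show "wedge 1 2 \<phi> \<psi> vs = 0 vs"
  proof (cases "length vs = 3")
    case True
    then obtain u v w where vs: "vs = [u, v, w]"
      by (auto simp: length_Suc_conv numeral_3_eq_3)
    obtain s t s' t' s'' t'' where uvw: "u = s *\<^sub>R a + t *\<^sub>R b"
      "v = s' *\<^sub>R a + t' *\<^sub>R b" "w = s'' *\<^sub>R a + t'' *\<^sub>R b"
      using assms(1) unfolding spans_plane_def by metis
    show ?thesis
      unfolding vs wedge_1_2[OF assms(3)]
      unfolding uvw alternating_form_one[OF assms(2)] alternating_form_two[OF assms(3)]
      by (simp add: algebra_simps)
  qed (simp add: wedge_length)
qed


section \<open>Isomorphic cohomology\<close>

text \<open>The isomorphism sends a coset to its image under \<open>\<Phi>\<close>, so no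
  representatives are chosen. All cosets lie in the subspace \<open>V\<close>, and injectivity of
  \<open>\<Phi>\<close> there makes taking images of subsets injective.\<close>

lemma quotient_isomorphic_image:
  fixes \<Phi> :: "'a::real_vector \<Rightarrow> 'b::real_vector"
  assumes lin: "linear \<Phi>" and V: "subspace V" "inj_on \<Phi> V" "Z \<subseteq> V" "B \<subseteq> V"
    and Z': "Z' = \<Phi> ` Z" and B': "B' = \<Phi> ` B"
  shows "quotient_isomorphic Z B Z' B'"
  unfolding quotient_isomorphic_def
proof (intro exI[of _ "image \<Phi>"] conjI ballI allI)
  have coset: "\<Phi> ` coset B x = coset B' (\<Phi> x)" for x
    by (simp add: coset_def B' image_image linear_add[OF lin])
  have sub: "S \<subseteq> V" if "S \<in> quotient_space Z B" for S
    using that V by (auto simp: quotient_space_def coset_def intro!: subspace_add)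
  have "inj_on (image \<Phi>) (quotient_space Z B)"
    using sub V(2) by (meson inj_onI inj_on_image_eq_iff)
  moreover have "image \<Phi> ` quotient_space Z B = quotient_space Z' B'"
    by (simp add: quotient_space_def Z' image_image coset)
  ultimately show "bij_betw (image \<Phi>) (quotient_space Z B) (quotient_space Z' B')"
    by (simp add: bij_betw_def)
  show "\<Phi> ` coset_add S S' = coset_add (\<Phi> ` S) (\<Phi> ` S')" for S S'
  proof (intro equalityI subsetI)
    fix z assume "z \<in> \<Phi> ` coset_add S S'"
    then obtain x y where "x \<in> S" "y \<in> S'" "z = \<Phi> (x + y)"
      by (auto simp: coset_add_def)
    then show "z \<in> coset_add (\<Phi> ` S) (\<Phi> ` S')"
      by (simp add: coset_add_def linear_add[OF lin]) blast
  next
    fix z assume "z \<in> coset_add (\<Phi> ` S) (\<Phi> ` S')"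
    then obtain x y where "x \<in> S" "y \<in> S'" "z = \<Phi> x + \<Phi> y"
      by (auto simp: coset_add_def)
    moreover from this have "x + y \<in> coset_add S S'"
      by (auto simp: coset_add_def)
    ultimately show "z \<in> \<Phi> ` coset_add S S'"
      by (metis imageI linear_add[OF lin])
  qed
  show "\<Phi> ` coset_scale B r S = coset_scale B' r (\<Phi> ` S)" for r S
    unfolding coset_scale_def B' by (force simp: linear_add[OF lin] linear_scale[OF lin])
qed

text \<open>Since \<open>d p x\<close> lies in \<open>V\<close>, where \<open>\<Phi>\<close> is
  injective, \<open>\<Phi> (d p x) = 0\<close> forces \<open>d p x = 0\<close>. Hence cocycles map
  onto cocycles; coboundaries map onto coboundaries by commutation alone.\<close>

lemma cohomology_isomorphic_image:
  fixes \<Phi> :: "'a::real_vector \<Rightarrow> 'b::real_vector"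
  assumes lin: "linear \<Phi>" and V: "subspace V" "inj_on \<Phi> V"
    and C: "\<And>p. C p \<subseteq> V" and d: "\<And>p x. x \<in> C p \<Longrightarrow> d p x \<in> V"
    and C': "\<And>p. C' p = \<Phi> ` C p"
    and comm: "\<And>p x. x \<in> C p \<Longrightarrow> d' p (\<Phi> x) = \<Phi> (d p x)"
  shows "cohomology_isomorphic C d C' d'"
  unfolding cohomology_isomorphic_def
proof
  fix p
  have ker: "\<Phi> y = 0 \<longleftrightarrow> y = 0" if "y \<in> V" for y
    using that inj_onD[OF V(2), of y 0] subspace_0[OF V(1)] linear_0[OF lin] by auto
  show "quotient_isomorphic (cocycles C d p) (coboundaries C d p) (cocycles C' d' p) (coboundaries C' d' p)"
  proof (rule quotient_isomorphic_image[OF lin V])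
    show "cocycles C d p \<subseteq> V"
      using C by (auto simp: cocycles_def)
    show "coboundaries C d p \<subseteq> V"
      using d subspace_0[OF V(1)] by (auto simp: coboundaries_def split: nat.split)
    show "cocycles C' d' p = \<Phi> ` cocycles C d p"
      using ker d by (auto simp: cocycles_def C' comm linear_0[OF lin])
    show "coboundaries C' d' p = \<Phi> ` coboundaries C d p"
      by (auto simp: coboundaries_def C' comm linear_0[OF lin] image_iff split: nat.split)
  qed
qed

section \<open>Fields on surfaces\<close>

lemma axis2_nth:
  "(axis 1 1 :: real^2) $ 1 = 1" "(axis 1 1 :: real^2) $ 2 = 0"
  "(axis 2 1 :: real^2) $ 1 = 0" "(axis 2 1 :: real^2) $ 2 = 1"
  by (simp_all add: axis_def)

text \<open>The left side is a bare variable, so the equation is used either instantiated or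
  flipped, to fold an expansion back into the vector.\<close>

lemma vec2_expand: "(v :: real^2) = v $ 1 *\<^sub>R axis 1 1 + v $ 2 *\<^sub>R axis 2 1"
  by (simp add: vec_eq_iff forall_2 axis2_nth)

lemma coord_covector_apply: "blinfun_apply (coord_covector i) v = v $ i"
  unfolding coord_covector_def
  by (simp add: bounded_linear_Blinfun_apply bounded_linear_vec_nth)

lemma covector2_expand:
  "(\<xi> :: (real^2) \<Rightarrow>\<^sub>L real) = \<xi> (axis 1 1) *\<^sub>R coord_covector 1 + \<xi> (axis 2 1) *\<^sub>R coord_covector 2"
proof (rule blinfun_eqI)
  fix v :: "real^2"
  have "\<xi> v = \<xi> (v $ 1 *\<^sub>R axis 1 1 + v $ 2 *\<^sub>R axis 2 1)"
    by (simp flip: vec2_expand)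
  then show "\<xi> v = blinfun_apply (\<xi> (axis 1 1) *\<^sub>R coord_covector 1 + \<xi> (axis 2 1) *\<^sub>R coord_covector 2) v"
    by (simp add: blinfun.bilinear_simps coord_covector_apply)
qed

lemma covector2_eqI:
  fixes \<xi> \<eta> :: "(real^2) \<Rightarrow>\<^sub>L real"
  assumes "\<xi> (axis 1 1) = \<eta> (axis 1 1)" "\<xi> (axis 2 1) = \<eta> (axis 2 1)"
  shows "\<xi> = \<eta>"
  using covector2_expand[of \<xi>] covector2_expand[of \<eta>] assms by simp

lemma spans_plane_axis: "spans_plane (axis 1 1 :: real^2) (axis 2 1)"
  unfolding spans_plane_def using vec2_expand by blast

lemma spans_plane_coord_covector:
  "spans_plane (coord_covector 1 :: (real^2) \<Rightarrow>\<^sub>L real) (coord_covector 2)"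
  unfolding spans_plane_def using covector2_expand by blast

text \<open>Holds at every \<open>c\<close> and \<open>x\<close>, because outside the chart images
  the value is the zero form.\<close>

lemma smooth_field_alternating: "smooth_field A r F \<Longrightarrow> alternating_form r (F c x)"
  unfolding smooth_field_def using alternating_form_zero by metis

lemma smooth_field_smooth: "smooth_field A r F \<Longrightarrow> c \<in> A \<Longrightarrow> smooth_on (chart_image c) (\<lambda>x. F c x vs)"
  by (simp add: smooth_field_def)

lemma smooth_field_outside: "smooth_field A r F \<Longrightarrow> \<not> (c \<in> A \<and> x \<in> chart_image c) \<Longrightarrow> F c x = 0"
  unfolding smooth_field_def by blast

lemma smooth_field_differentiable:
  "smooth_field A r F \<Longrightarrow> c \<in> A \<Longrightarrow> x \<in> chart_image c \<Longrightarrow> (\<lambda>y. F c y vs) differentiable at x"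
  by (rule smooth_on_differentiable[OF smooth_field_smooth])

lemma smooth_field_plane_eq_zero:
  fixes F :: "('m, 'n::finite, 'v::real_vector) field" and a b :: 'v
  shows
  "spans_plane a b \<Longrightarrow> smooth_field A r F \<Longrightarrow> r \<ge> 3 \<Longrightarrow> F = 0"
  by (intro ext) (simp add: alternating_form_plane_eq_zero[OF _ smooth_field_alternating])

text \<open>The derivative in a fixed direction is linear in the differentiated function, so
  linearity in each slot and alternation survive. Derivatives of a field can therefore be expanded
  in components like the field itself.\<close>

lemma alternating_form_frechet_derivative:
  fixes F :: "'a::real_normed_vector \<Rightarrow> 'b::real_vector list \<Rightarrow> real"
  assumes alt: "\<And>y. alternating_form r (F y)" and diff: "\<And>vs. (\<lambda>y. F y vs) differentiable at x"
  shows "alternating_form r (\<lambda>vs. frechet_derivative (\<lambda>y. F y vs) (at x) h)"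
  unfolding alternating_form_def
proof (intro conjI allI impI)
  fix vs :: "'b list" and i assume i: "length vs = r \<and> i < r"
  then have lin: "linear (\<lambda>v. F y (vs[i := v]))" for y
    using alternating_form_linear[OF alt] by blast
  show "linear (\<lambda>v. frechet_derivative (\<lambda>y. F y (vs[i := v])) (at x) h)"
  proof (rule linearI)
    show "frechet_derivative (\<lambda>y. F y (vs[i := v + w])) (at x) h =
        frechet_derivative (\<lambda>y. F y (vs[i := v])) (at x) h +
        frechet_derivative (\<lambda>y. F y (vs[i := w])) (at x) h" for v w
      unfolding linear_add[OF lin]
      by (rule fun_cong[OF frechet_derivative_at[symmetric, OF has_derivative_add]])
        (use diff in \<open>simp_all flip: frechet_derivative_works\<close>)
    show "frechet_derivative (\<lambda>y. F y (vs[i := s *\<^sub>R v])) (at x) h =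
        s *\<^sub>R frechet_derivative (\<lambda>y. F y (vs[i := v])) (at x) h" for s v
      unfolding linear_scale[OF lin]
      by (rule fun_cong[OF frechet_derivative_at[symmetric, OF has_derivative_scaleR_right]])
        (use diff in \<open>simp_all flip: frechet_derivative_works\<close>)
  qed
next
  fix vs :: "'b list" assume "length vs \<noteq> r"
  then show "frechet_derivative (\<lambda>y. F y vs) (at x) h = 0"
    using alternating_form_length[OF alt] by simp
next
  fix vs :: "'b list" and i j assume "length vs = r \<and> i < j \<and> j < r \<and> vs ! i = vs ! j"
  then show "frechet_derivative (\<lambda>y. F y vs) (at x) h = 0"
    using alternating_form_eq_zero[OF alt, of vs i j] by simp
qed

text \<open>The list function has the shape in which \<open>ext_deriv_0\<close> and
  \<open>theta_eq\<close> express the differential of a function.\<close>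

lemma alternating_form_of_linear:
  "linear L \<Longrightarrow> alternating_form 1 (\<lambda>vs. if length vs = 1 then L (vs ! 0) else 0)"
  by (auto simp: alternating_form_def)

text \<open>The first slot is contracted in Hamiltonian fields, the last one in the Schouten
  bracket.\<close>

lemma alternating_form_contract:
  assumes "alternating_form 2 \<phi>"
  shows "alternating_form 1 (\<lambda>vs. \<phi> (v # vs))" "alternating_form 1 (contract_last \<phi> v)"
  using alternating_form_two_linear[OF assms] alternating_form_length[OF assms]
  by (auto simp: alternating_form_def contract_last_def length_Suc_conv)

section \<open>Musical isomorphisms of an area form\<close>

definition flat :: "('m, 2) form \<Rightarrow> ('m, 2) chart \<Rightarrow> real^2 \<Rightarrow> real^2 \<Rightarrow> (real^2) \<Rightarrow>\<^sub>L real" where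
  "flat \<nu> c x v = Blinfun (\<lambda>w. \<nu> c x [v, w])"

text \<open>The solution \<open>v\<close> of \<open>flat \<nu> c x v = \<xi>\<close>: with
  \<open>n\<close> the value of \<nu> on the standard basis, the left side has components
  \<open>- n * v $ 2\<close> and \<open>n * v $ 1\<close>.\<close>

definition sharp :: "('m, 2) form \<Rightarrow> ('m, 2) chart \<Rightarrow> real^2 \<Rightarrow> ((real^2) \<Rightarrow>\<^sub>L real) \<Rightarrow> real^2" where
  "sharp \<nu> c x \<xi> = inverse (\<nu> c x [axis 1 1, axis 2 1]) *\<^sub>R
    (\<xi> (axis 2 1) *\<^sub>R axis 1 1 - \<xi> (axis 1 1) *\<^sub>R axis 2 1)"

text \<open>This is the map \<Phi> of the overview.\<close>

definition lower :: "('m, 2) form \<Rightarrow> ('m, 2) mvec \<Rightarrow> ('m, 2) form" where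
  "lower \<nu> P = (\<lambda>c x vs. P c x (map (flat \<nu> c x) vs))"

definition raise :: "('m, 2) form \<Rightarrow> ('m, 2) form \<Rightarrow> ('m, 2) mvec" where
  "raise \<nu> \<omega> = (\<lambda>c x \<xi>s. \<omega> c x (map (sharp \<nu> c x) \<xi>s))"

lemma linear_lower: "linear (lower \<nu>)"
  by (simp add: linear_iff lower_def fun_eq_iff scaleR_fun_def)

lemma linear_sharp: "linear (sharp \<nu> c x)"
  by (simp add: linear_iff sharp_def blinfun.bilinear_simps algebra_simps)

locale oriented_surface =
  fixes X :: "'m topology" and A :: "('m, 2) chart set" and \<nu> :: "('m, 2) form"
  assumes oriented: "oriented_manifold X A" and volume: "volume_form A \<nu>"
begin

section \<open>Charts and coordinate changes\<close>

lemma open_chart_image: "c \<in> A \<Longrightarrow> open (chart_image c)"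
  using oriented by (auto simp: oriented_manifold_def smooth_manifold_def smooth_atlas_def is_chart_def)

lemma chart_inv_chart:
  assumes "c \<in> A" "m \<in> fst c"
  shows "chart_inv c (snd c m) = m"
proof -
  have "openin X (fst c)" "homeomorphic_map (subtopology X (fst c)) (top_of_set (chart_image c)) (snd c)"
    using oriented assms(1)
    by (auto simp: oriented_manifold_def smooth_manifold_def smooth_atlas_def is_chart_def)
  then have "inj_on (snd c) (fst c)"
    using homeomorphic_imp_injective_map[of "subtopology X (fst c)"]
    by (metis openin_subset topspace_subtopology_subset)
  with assms(2) show ?thesis
    by (simp add: chart_inv_def)
qed

lemma overlap_subset: "x \<in> overlap c c' \<Longrightarrow> x \<in> chart_image c"
  by (auto simp: overlap_def chart_image_def)

lemma transition_in_chart_image: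
  "c \<in> A \<Longrightarrow> x \<in> overlap c c' \<Longrightarrow> transition c c' x \<in> chart_image c'"
  using chart_inv_chart[of c] by (auto simp: overlap_def chart_image_def transition_def)

lemma linear_transition_deriv:
  assumes "c \<in> A" "c' \<in> A" "x \<in> overlap c c'"
  shows "linear (transition_deriv c c' x)"
proof -
  have "smooth_on (overlap c c') (transition c c')"
    using oriented assms by (auto simp: oriented_manifold_def smooth_manifold_def smooth_atlas_def)
  then show ?thesis
    using smooth_on_differentiable assms(3) unfolding transition_deriv_def
    by (blast intro: linear_frechet_derivative)
qed

lemma transition_deriv_apply:
  assumes "c \<in> A" "c' \<in> A" "x \<in> overlap c c'"
  shows "blinfun_apply (Blinfun (transition_deriv c c' x)) = transition_deriv c c' x"
  using linear_transition_deriv[OF assms]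
  by (simp add: bounded_linear_Blinfun_apply linear_conv_bounded_linear)

text \<open>The Jacobian determinants of an oriented atlas are positive, hence nonzero.\<close>

lemma surj_transition_deriv:
  assumes "c \<in> A" "c' \<in> A" "x \<in> overlap c c'"
  shows "surj (transition_deriv c c' x)"
proof -
  have "det (matrix (transition_deriv c c' x)) \<noteq> 0"
    using oriented assms by (fastforce simp: oriented_manifold_def)
  then show ?thesis
    using det_nz_iff_inj linear_inj_imp_surj linear_transition_deriv[OF assms] by blast
qed

section \<open>The area form and its musical isomorphisms at a point\<close>

lemma volume_field: "smooth_field A 2 \<nu>"
  and volume_transition: "c \<in> A \<Longrightarrow> c' \<in> A \<Longrightarrow> x \<in> overlap c c' \<Longrightarrow>
    \<nu> c x vs = \<nu> c' (transition c c' x) (map (transition_deriv c c' x) vs)"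
  using volume by (auto simp: volume_form_def Forms_def)

lemmas alternating_volume = smooth_field_alternating[OF volume_field]

text \<open>A 2-form on the plane is a multiple of the determinant, so vanishing on the basis would
  make \<nu> vanish at \<open>x\<close>.\<close>

lemma volume_nonzero:
  assumes "c \<in> A" "x \<in> chart_image c"
  shows "\<nu> c x [axis 1 1, axis 2 1] \<noteq> 0"
proof
  assume 0: "\<nu> c x [axis 1 1, axis 2 1] = 0"
  have "\<nu> c x vs = 0" for vs
  proof (cases "length vs = 2")
    case True
    then obtain v w where "vs = [v, w]"
      by (auto simp: length_Suc_conv numeral_2_eq_2)
    then show ?thesis
      using 0 vec2_expand[of v] vec2_expand[of w] alternating_form_two[OF alternating_volume]
      by (metis mult_zero_right)
  qed (simp add: alternating_form_length[OF alternating_volume])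
  then show False
    using volume assms by (auto simp: volume_form_def fun_eq_iff)
qed

lemma flat_apply: "blinfun_apply (flat \<nu> c x v) w = \<nu> c x [v, w]"
  unfolding flat_def using alternating_form_two_linear(2)[OF alternating_volume]
  by (simp add: bounded_linear_Blinfun_apply linear_conv_bounded_linear)

lemma flat_axis:
  "blinfun_apply (flat \<nu> c x v) (axis 1 1) = - (v $ 2 * \<nu> c x [axis 1 1, axis 2 1])"
  "blinfun_apply (flat \<nu> c x v) (axis 2 1) = v $ 1 * \<nu> c x [axis 1 1, axis 2 1]"
proof -
  have *: "\<nu> c x [v, w] = (v $ 1 * w $ 2 - v $ 2 * w $ 1) * \<nu> c x [axis 1 1, axis 2 1]" for w
    using vec2_expand[of v] vec2_expand[of w] alternating_form_two[OF alternating_volume] by metis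
  show "blinfun_apply (flat \<nu> c x v) (axis 1 1) = - (v $ 2 * \<nu> c x [axis 1 1, axis 2 1])"
    "blinfun_apply (flat \<nu> c x v) (axis 2 1) = v $ 1 * \<nu> c x [axis 1 1, axis 2 1]"
    unfolding flat_apply by (subst *, simp add: axis2_nth)+
qed

lemma flat_expand:
  "flat \<nu> c x v = (- (v $ 2 * \<nu> c x [axis 1 1, axis 2 1])) *\<^sub>R coord_covector 1 +
     (v $ 1 * \<nu> c x [axis 1 1, axis 2 1]) *\<^sub>R coord_covector 2"
  by (subst covector2_expand) (simp add: flat_axis)

lemma linear_flat: "linear (flat \<nu> c x)"
  unfolding flat_expand by (simp add: linear_iff algebra_simps)

lemma sharp_flat: "c \<in> A \<Longrightarrow> x \<in> chart_image c \<Longrightarrow> sharp \<nu> c x (flat \<nu> c x v) = v"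
  using volume_nonzero[of c x] by (simp add: sharp_def flat_axis axis2_nth vec_eq_iff forall_2)

lemma flat_sharp: "c \<in> A \<Longrightarrow> x \<in> chart_image c \<Longrightarrow> flat \<nu> c x (sharp \<nu> c x \<xi>) = \<xi>"
  using volume_nonzero[of c x]
  by (intro covector2_eqI) (simp_all add: flat_axis, simp_all add: sharp_def axis2_nth)

text \<open>This restates the invariance of \<nu> under pullback, with the first argument
  fixed.\<close>

lemma flat_transition:
  assumes "c \<in> A" "c' \<in> A" "x \<in> overlap c c'"
  shows "flat \<nu> c' (transition c c' x) (transition_deriv c c' x v) o\<^sub>L Blinfun (transition_deriv c c' x)
    = flat \<nu> c x v"
  by (rule blinfun_eqI) (simp add: flat_apply transition_deriv_apply[OF assms] volume_transition[OF assms])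

text \<open>Both sides have the same image under \<open>flat\<close> in the chart \<open>c'\<close>:
  by \<open>flat_transition\<close> these images agree after pullback along the derivative of the
  coordinate change, and surjectivity of that derivative cancels the pullback.\<close>

lemma sharp_transition:
  assumes "c \<in> A" "c' \<in> A" "x \<in> overlap c c'"
  shows "transition_deriv c c' x (sharp \<nu> c x (\<xi> o\<^sub>L Blinfun (transition_deriv c c' x)))
    = sharp \<nu> c' (transition c c' x) \<xi>"
proof -
  let ?D = "transition_deriv c c' x" and ?y = "transition c c' x"
  let ?v = "sharp \<nu> c x (\<xi> o\<^sub>L Blinfun ?D)"
  have "flat \<nu> c' ?y (?D ?v) o\<^sub>L Blinfun ?D = \<xi> o\<^sub>L Blinfun ?D"
    using flat_transition[OF assms] flat_sharp overlap_subset assms by metis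
  then have "blinfun_apply (flat \<nu> c' ?y (?D ?v)) (?D w) = \<xi> (?D w)" for w
    using transition_deriv_apply[OF assms] by (metis blinfun_apply_blinfun_compose)
  then have "flat \<nu> c' ?y (?D ?v) = \<xi>"
    using surj_transition_deriv[OF assms] by (intro blinfun_eqI) (metis surjD)
  then show ?thesis
    using sharp_flat[OF assms(2) transition_in_chart_image[OF assms(1,3)]] by metis
qed

section \<open>The bijection between multivector fields and forms\<close>

lemma lower_Forms:
  assumes "P \<in> MVecs A p"
  shows "lower \<nu> P \<in> Forms A p"
proof -
  have P: "smooth_field A p P" and trans: "\<And>c c' x \<xi>s. c \<in> A \<Longrightarrow> c' \<in> A \<Longrightarrow> x \<in> overlap c c' \<Longrightarrow>
      P c' (transition c c' x) \<xi>s = P c x (map (\<lambda>\<xi>. \<xi> o\<^sub>L Blinfun (transition_deriv c c' x)) \<xi>s)"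
    using assms by (auto simp: MVecs_def)
  have "smooth_on (chart_image c) (\<lambda>x. lower \<nu> P c x vs)" if "c \<in> A" for c vs
    unfolding lower_def
  proof (rule smooth_on_alternating_map[OF open_chart_image[OF that] spans_plane_coord_covector
        smooth_field_alternating[OF P] smooth_field_smooth[OF P that]])
    \<comment> \<open>The sign is attached to the constant \<open>v $ 2\<close>, so each coefficient
      is a constant times a component of \<nu>, as \<open>smooth_on_mult\<close> requires.\<close>
    show "flat \<nu> c x v = (- v $ 2 * \<nu> c x [axis 1 1, axis 2 1]) *\<^sub>R coord_covector 1 +
        (v $ 1 * \<nu> c x [axis 1 1, axis 2 1]) *\<^sub>R coord_covector 2" for x v
      by (subst flat_expand) simp
  qed (intro smooth_on_mult smooth_on_const open_chart_image smooth_field_smooth[OF volume_field] that)+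
  then have "smooth_field A p (lower \<nu> P)"
    using alternating_form_map[OF smooth_field_alternating[OF P] linear_flat] smooth_field_outside[OF P]
    unfolding smooth_field_def by (auto simp: lower_def fun_eq_iff)
  then show ?thesis
    by (auto simp: Forms_def lower_def trans o_def flat_transition)
qed

lemma raise_MVecs:
  assumes "\<omega> \<in> Forms A p"
  shows "raise \<nu> \<omega> \<in> MVecs A p"
proof -
  have \<omega>: "smooth_field A p \<omega>" and trans: "\<And>c c' x vs. c \<in> A \<Longrightarrow> c' \<in> A \<Longrightarrow> x \<in> overlap c c' \<Longrightarrow>
      \<omega> c x vs = \<omega> c' (transition c c' x) (map (transition_deriv c c' x) vs)"
    using assms by (auto simp: Forms_def)
  have "smooth_on (chart_image c) (\<lambda>x. raise \<nu> \<omega> c x \<xi>s)" if "c \<in> A" for c \<xi>s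
    unfolding raise_def
  proof (rule smooth_on_alternating_map[OF open_chart_image[OF that] spans_plane_axis
        smooth_field_alternating[OF \<omega>] smooth_field_smooth[OF \<omega> that]])
    show "sharp \<nu> c x \<xi> = (\<xi> (axis 2 1) * inverse (\<nu> c x [axis 1 1, axis 2 1])) *\<^sub>R axis 1 1 +
        (- \<xi> (axis 1 1) * inverse (\<nu> c x [axis 1 1, axis 2 1])) *\<^sub>R axis 2 1" for x \<xi>
      by (simp add: sharp_def algebra_simps)
  qed (intro smooth_on_mult smooth_on_const smooth_on_inverse open_chart_image
      smooth_field_smooth[OF volume_field] volume_nonzero that; assumption?)+
  then have "smooth_field A p (raise \<nu> \<omega>)"
    using alternating_form_map[OF smooth_field_alternating[OF \<omega>] linear_sharp] smooth_field_outside[OF \<omega>]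
    unfolding smooth_field_def by (auto simp: raise_def fun_eq_iff)
  then show ?thesis
    by (auto simp: MVecs_def raise_def trans o_def sharp_transition)
qed

lemma lower_raise:
  assumes "\<omega> \<in> Forms A p"
  shows "lower \<nu> (raise \<nu> \<omega>) = \<omega>"
proof (intro ext)
  fix c x vs
  have \<omega>: "smooth_field A p \<omega>" using assms by (simp add: Forms_def)
  show "lower \<nu> (raise \<nu> \<omega>) c x vs = \<omega> c x vs"
    using smooth_field_outside[OF \<omega>, of c x] sharp_flat[of c x]
    by (cases "c \<in> A \<and> x \<in> chart_image c") (auto simp: lower_def raise_def o_def)
qed

lemma Forms_eq_lower: "Forms A p = lower \<nu> ` MVecs A p"
  using lower_Forms raise_MVecs lower_raise by (force simp: image_iff)

text \<open>The ambient subspace for \<open>cohomology_isomorphic_image\<close>. It contains the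
  multivector fields of all degrees and everything built with \<open>on_charts\<close>, in
  particular the values of \<open>d_Pi_alpha\<close>.\<close>

definition supported :: "('m, 2) mvec set" where
  "supported = {P. \<forall>c x. \<not> (c \<in> A \<and> x \<in> chart_image c) \<longrightarrow> P c x = 0}"

lemma subspace_supported: "subspace supported"
  by (auto simp: subspace_def supported_def scaleR_fun_def fun_eq_iff)

lemma MVecs_supported: "MVecs A p \<subseteq> supported"
  by (auto simp: MVecs_def supported_def smooth_field_def)

text \<open>On chart images every list of covectors is the \<open>flat\<close> image of a list of
  vectors, namely of its \<open>sharp\<close> image, so a family is recovered from its
  lowering.\<close>

lemma inj_on_lower: "inj_on (lower \<nu>) supported"
proof (rule inj_onI, intro ext)
  fix P Q c x \<xi>s
  assume PQ: "P \<in> supported" "Q \<in> supported" "lower \<nu> P = lower \<nu> Q"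
  have "P c x (map (flat \<nu> c x) (map (sharp \<nu> c x) \<xi>s)) =
      Q c x (map (flat \<nu> c x) (map (sharp \<nu> c x) \<xi>s))"
    using PQ(3) unfolding lower_def by metis
  then show "P c x \<xi>s = Q c x \<xi>s"
    using PQ(1,2) flat_sharp[of c x]
    by (cases "c \<in> A \<and> x \<in> chart_image c") (simp_all add: supported_def o_def del: split_paired_All)
qed

end

section \<open>The differentials in coordinates\<close>

abbreviation pd :: "2 \<Rightarrow> (real^2 \<Rightarrow> real) \<Rightarrow> real^2 \<Rightarrow> real" where
  "pd i g x \<equiv> frechet_derivative g (at x) (axis i 1)"

lemma frechet_derivative_pd:
  fixes g :: "real^2 \<Rightarrow> real"
  assumes "g differentiable at x"
  shows "frechet_derivative g (at x) v = v $ 1 * pd 1 g x + v $ 2 * pd 2 g x"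
proof -
  note lin = linear_frechet_derivative[OF assms]
  have "frechet_derivative g (at x) (v $ 1 *\<^sub>R axis 1 1 + v $ 2 *\<^sub>R axis 2 1) =
      v $ 1 * pd 1 g x + v $ 2 * pd 2 g x"
    by (simp add: linear_add[OF lin] linear_scale[OF lin])
  then show ?thesis
    by (simp flip: vec2_expand)
qed

lemma ext_deriv_0:
  "c \<in> A \<Longrightarrow> x \<in> chart_image c \<Longrightarrow> ext_deriv A 0 \<phi> c x =
    (\<lambda>vs. if length vs = 1 then frechet_derivative (\<lambda>y. \<phi> c y []) (at x) (vs ! 0) else 0)"
  by (auto simp: ext_deriv_def on_charts_def fun_eq_iff)

lemma ext_deriv_1:
  assumes "c \<in> A" "x \<in> chart_image c"
  shows "ext_deriv A 1 \<phi> c x [v, w] =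
    frechet_derivative (\<lambda>y. \<phi> c y [w]) (at x) v - frechet_derivative (\<lambda>y. \<phi> c y [v]) (at x) w"
  using assms by (simp add: ext_deriv_def on_charts_def)

lemma ext_deriv_2:
  assumes "c \<in> A" "x \<in> chart_image c"
  shows "ext_deriv A 2 \<phi> c x [u, v, w] =
    frechet_derivative (\<lambda>y. \<phi> c y [v, w]) (at x) u - frechet_derivative (\<lambda>y. \<phi> c y [u, w]) (at x) v +
    frechet_derivative (\<lambda>y. \<phi> c y [u, v]) (at x) w"
  using assms by (simp add: ext_deriv_def on_charts_def numeral_2_eq_2)

lemma field_1_apply:
  assumes "alternating_form 1 \<phi>"
  shows "\<phi> [v] = v $ 1 * \<phi> [axis 1 1] + v $ 2 * \<phi> [axis 2 1 :: real^2]"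
  using alternating_form_one[OF assms, of "v $ 1" "axis 1 1" "v $ 2" "axis 2 1"] by (simp flip: vec2_expand)

lemma field_2_apply:
  assumes "alternating_form 2 \<phi>"
  shows "\<phi> [v, w] = (v $ 1 * w $ 2 - v $ 2 * w $ 1) * \<phi> [axis 1 1, axis 2 1 :: real^2]"
  using alternating_form_two[OF assms, of "v $ 1" "axis 1 1" "v $ 2" "axis 2 1" "w $ 1" "w $ 2"]
  by (simp flip: vec2_expand)

lemma mvec_1_apply:
  fixes \<phi> :: "((real^2) \<Rightarrow>\<^sub>L real) list \<Rightarrow> real"
  assumes "alternating_form 1 \<phi>"
  shows "\<phi> [\<xi>] = \<xi> (axis 1 1) * \<phi> [coord_covector 1] +
    \<xi> (axis 2 1) * \<phi> [coord_covector 2]"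
  using alternating_form_one[OF assms, of "\<xi> (axis 1 1)" "coord_covector 1" "\<xi> (axis 2 1)" "coord_covector 2"]
  by (simp flip: covector2_expand)

lemma mvec_2_apply:
  fixes \<phi> :: "((real^2) \<Rightarrow>\<^sub>L real) list \<Rightarrow> real"
  assumes "alternating_form 2 \<phi>"
  shows "\<phi> [\<xi>, \<eta>] = (\<xi> (axis 1 1) * \<eta> (axis 2 1) - \<xi> (axis 2 1) * \<eta> (axis 1 1)) *
    \<phi> [coord_covector 1, coord_covector 2]"
  using alternating_form_two[OF assms, of "\<xi> (axis 1 1)" "coord_covector 1" "\<xi> (axis 2 1)" "coord_covector 2"
      "\<eta> (axis 1 1)" "\<eta> (axis 2 1)"]
  by (simp flip: covector2_expand)

lemmas coord_simps = coord_covector_apply axis2_nth sum_2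

lemma alternating_partial_mvec:
  assumes "smooth_field A r P" "c \<in> A" "x \<in> chart_image c"
  shows "alternating_form r (partial_mvec i P c x)"
  using alternating_form_frechet_derivative[OF smooth_field_alternating[OF assms(1)]
      smooth_field_differentiable[OF assms]]
  unfolding partial_mvec_def .

text \<open>The extended list is nonempty, hence too long for degree 0. This removes the Schouten
  term in which \<open>p - 1\<close> is truncated.\<close>

lemma contract_last_degree_0: "smooth_field A 0 g \<Longrightarrow> contract_last (g c x) \<eta> = 0"
  using alternating_form_length[OF smooth_field_alternating, of A 0 g]
  by (auto simp: contract_last_def fun_eq_iff)

text \<open>For \<open>p > 0\<close> all wedge products involved have total degree
  \<open>p + 1\<close>. For \<open>p = 0\<close> the first Schouten term formally has degree 2, but
  its contracted factor is zero.\<close>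

lemma d_Pi_alpha_length:
  "length \<xi>s \<noteq> Suc p \<Longrightarrow> smooth_field A p P \<Longrightarrow> d_Pi_alpha A \<pi> \<alpha> p P c x \<xi>s = 0"
  by (cases p) (auto simp: d_Pi_alpha_def d_Pi_def schouten_def on_charts_def wedge_length
      contract_last_degree_0 wedge_zero)

lemma d_f_theta_length: "length vs \<noteq> Suc p \<Longrightarrow> d_f_theta A f \<theta> p \<phi> c x vs = 0"
  by (auto simp: d_f_theta_def d_f_def ext_deriv_def on_charts_def wedge_def)

locale poisson_surface = oriented_surface X A \<nu>
  for X :: "'m topology" and A :: "('m, 2) chart set" and \<nu> :: "('m, 2) form" +
  fixes \<pi> :: "('m, 2) mvec" and \<alpha> :: "'m \<Rightarrow> real"
  assumes poisson: "poisson_structure A \<pi>" and twist: "smooth_function A \<alpha>"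
begin

abbreviation f :: "('m, 2) form" where "f \<equiv> bivector_contract A \<pi> \<nu>"
abbreviation \<theta> :: "('m, 2) form" where "\<theta> \<equiv> ext_deriv A 0 (scalar_field A \<alpha>)"

section \<open>The bivector, \<theta>, the Hamiltonian field and \<open>f\<close> in a chart\<close>

lemma bivector_field: "smooth_field A 2 \<pi>"
  using poisson by (simp add: poisson_structure_def MVecs_def)

lemmas alternating_bivector = smooth_field_alternating[OF bivector_field]

lemma twist_differentiable: "c \<in> A \<Longrightarrow> x \<in> chart_image c \<Longrightarrow> (\<alpha> \<circ> chart_inv c) differentiable at x"
  using twist smooth_on_differentiable unfolding smooth_function_def by blast

lemma theta_eq:
  assumes "c \<in> A" "x \<in> chart_image c"
  shows "\<theta> c x = (\<lambda>vs. if length vs = 1 then frechet_derivative (\<alpha> \<circ> chart_inv c) (at x) (vs ! 0) else 0)"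
proof -
  \<comment> \<open>\<open>scalar_field\<close> is cut off to 0 outside the chart image, unlike the
    function on the left; they agree on the open chart image, which suffices for the
    derivatives.\<close>
  have eq: "frechet_derivative (\<alpha> \<circ> chart_inv c) (at x) =
      frechet_derivative (\<lambda>y. scalar_field A \<alpha> c y ([] :: (real^2) list)) (at x)"
    using assms
    by (intro frechet_derivative_transform_within_open[of _ _ "chart_image c"] twist_differentiable open_chart_image)
      (auto simp: scalar_field_def on_charts_def)
  show ?thesis
    unfolding ext_deriv_0[OF assms] eq ..
qed

lemma hamiltonian_field_eq:
  assumes "c \<in> A" "x \<in> chart_image c"
  shows "hamiltonian_field A \<pi> \<alpha> c x =
    (\<lambda>\<eta>s. \<pi> c x (Blinfun (frechet_derivative (\<alpha> \<circ> chart_inv c) (at x)) # \<eta>s))"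
  using assms by (simp add: hamiltonian_field_def on_charts_def)

lemma hamiltonian_field_apply:
  assumes "c \<in> A" "x \<in> chart_image c"
  shows "hamiltonian_field A \<pi> \<alpha> c x [\<xi>] =
    (pd 1 (\<alpha> \<circ> chart_inv c) x * \<xi> (axis 2 1) - pd 2 (\<alpha> \<circ> chart_inv c) x * \<xi> (axis 1 1)) *
    \<pi> c x [coord_covector 1, coord_covector 2]"
  unfolding hamiltonian_field_eq[OF assms]
  using linear_frechet_derivative[OF twist_differentiable[OF assms]]
  by (subst mvec_2_apply[OF alternating_bivector])
    (simp add: bounded_linear_Blinfun_apply linear_conv_bounded_linear)

text \<open>The diagonal terms of the double sum vanish, and the two others are equal because both
  factors change sign; this cancels the division by 2.\<close>

lemma f_apply:
  assumes "c \<in> A" "x \<in> chart_image c"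
  shows "f c x [] = \<pi> c x [coord_covector 1, coord_covector 2] * \<nu> c x [axis 1 1, axis 2 1]"
  using assms
  by (simp add: bivector_contract_def on_charts_def sum_2 alternating_form_two_self[OF alternating_bivector]
      alternating_form_two_swap[OF alternating_bivector, of _ _ "coord_covector 2" "coord_covector 1"]
      alternating_form_two_swap[OF alternating_volume, of _ _ "axis 2 1" "axis 1 1"])

lemma f_has_derivative:
  assumes "c \<in> A" "x \<in> chart_image c"
  defines "b \<equiv> \<lambda>y. \<pi> c y [coord_covector 1, coord_covector 2]" and "n \<equiv> \<lambda>y. \<nu> c y [axis 1 1, axis 2 1]"
  shows "((\<lambda>y. f c y []) has_derivative
    (\<lambda>v. b x * frechet_derivative n (at x) v + frechet_derivative b (at x) v * n x)) (at x)"
proof (rule has_derivative_transform_within_open[OF has_derivative_mult_real open_chart_image[OF assms(1)] assms(2)])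
  show "b differentiable at x" "n differentiable at x"
    unfolding b_def n_def
    using smooth_field_differentiable[OF _ assms(1,2)] bivector_field volume_field by blast+
qed (use assms f_apply in auto)

text \<open>Only the second Schouten term survives; it is the Hamiltonian field of \<open>g\<close>,
  so the result is \<open>X_g - g X_\<alpha>\<close> in components.\<close>

lemma d_Pi_alpha_0:
  assumes "smooth_field A 0 g" "c \<in> A" "x \<in> chart_image c"
  defines "g' \<equiv> \<lambda>i. pd i (\<lambda>y. g c y []) x" and "a \<equiv> \<lambda>i. pd i (\<alpha> \<circ> chart_inv c) x"
  shows "d_Pi_alpha A \<pi> \<alpha> 0 g c x [\<xi>] = \<pi> c x [coord_covector 1, coord_covector 2] *
    ((g' 1 - g c x [] * a 1) * \<xi> (axis 2 1) - (g' 2 - g c x [] * a 2) * \<xi> (axis 1 1))"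
proof -
  define B where "B = \<pi> c x [coord_covector 1, coord_covector 2]"
  have \<pi>: "contract_last (\<pi> c x) \<eta> [\<xi>] =
      (\<xi> (axis 1 1) * \<eta> (axis 2 1) - \<xi> (axis 2 1) * \<eta> (axis 1 1)) * B" for \<eta>
    unfolding contract_last_def B_def append_Cons append_Nil by (rule mvec_2_apply[OF alternating_bivector])
  show ?thesis
    using assms(2,3)
    by (simp add: \<pi> d_Pi_alpha_def d_Pi_def schouten_def on_charts_def contract_last_degree_0[OF assms(1)]
        wedge_zero wedge_1_0[unfolded One_nat_def]
        hamiltonian_field_apply partial_mvec_def coord_simps
        g'_def a_def algebra_simps flip: B_def)
qed

text \<open>In degree 0 the term with \<open>df\<close> has coefficient 0, which leaves
  \<open>f (d\<phi> - \<phi> d\<alpha>)\<close>.\<close>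

lemma d_f_theta_0:
  assumes "smooth_field A 0 \<phi>" "c \<in> A" "x \<in> chart_image c"
  defines "\<phi>' \<equiv> \<lambda>i. pd i (\<lambda>y. \<phi> c y []) x" and "a \<equiv> \<lambda>i. pd i (\<alpha> \<circ> chart_inv c) x"
  shows "d_f_theta A f \<theta> 0 \<phi> c x [v] = f c x [] *
    ((\<phi>' 1 - \<phi> c x [] * a 1) * v $ 1 + (\<phi>' 2 - \<phi> c x [] * a 2) * v $ 2)"
  using assms(2,3)
  by (simp add: d_f_theta_def d_f_def on_charts_def ext_deriv_0[where \<phi> = \<phi>]
      theta_eq wedge_1_0[unfolded One_nat_def]
      frechet_derivative_pd[OF smooth_field_differentiable[OF assms(1-3)], of _ v]
      frechet_derivative_pd[OF twist_differentiable[OF assms(2,3)], of v]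
      \<phi>'_def a_def algebra_simps)

text \<open>The Lie derivative of the bivector along \<open>Y\<close> has component
  \<open>Y(b) - b div Y\<close>; the twist contributes \<open>b Y(\<alpha>)\<close>, positive since
  the Hamiltonian field of \<alpha> wedged with \<open>Y\<close> has component
  \<open>- b Y(\<alpha>)\<close>.\<close>

lemma d_Pi_alpha_1:
  assumes "smooth_field A 1 Y" "c \<in> A" "x \<in> chart_image c"
  defines "b \<equiv> \<lambda>y. \<pi> c y [coord_covector 1, coord_covector 2]" and "Z \<equiv> \<lambda>i y. Y c y [coord_covector i]"
    and "a \<equiv> \<lambda>i. pd i (\<alpha> \<circ> chart_inv c) x"
  shows "d_Pi_alpha A \<pi> \<alpha> 1 Y c x [\<xi>, \<eta>] =
    (\<xi> (axis 1 1) * \<eta> (axis 2 1) - \<xi> (axis 2 1) * \<eta> (axis 1 1)) *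
    (Z 1 x * pd 1 b x + Z 2 x * pd 2 b x - b x * (pd 1 (Z 1) x + pd 2 (Z 2) x) +
     b x * (Z 1 x * a 1 + Z 2 x * a 2))"
proof -
  have Y: "Y c x [\<xi>] = \<xi> (axis 1 1) * Z 1 x + \<xi> (axis 2 1) * Z 2 x" for \<xi>
    unfolding Z_def by (rule mvec_1_apply[OF smooth_field_alternating[OF assms(1)]])
  have dY: "partial_mvec i Y c x [\<xi>] = \<xi> (axis 1 1) * pd i (Z 1) x + \<xi> (axis 2 1) * pd i (Z 2) x" for i \<xi>
    using mvec_1_apply[OF alternating_partial_mvec[OF assms(1-3)]] unfolding Z_def partial_mvec_def by blast
  have d\<pi>: "partial_mvec i \<pi> c x [\<xi>, \<eta>] =
      (\<xi> (axis 1 1) * \<eta> (axis 2 1) - \<xi> (axis 2 1) * \<eta> (axis 1 1)) * pd i b x" for i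
    using mvec_2_apply[OF alternating_partial_mvec[OF bivector_field assms(2,3)]]
    unfolding b_def partial_mvec_def by blast
  have cY: "contract_last (Y c x) (coord_covector i) [] = Z i x" for i
    by (simp add: contract_last_def Z_def)
  have c\<pi>: "contract_last (\<pi> c x) \<zeta> [\<xi>] =
      (\<xi> (axis 1 1) * \<zeta> (axis 2 1) - \<xi> (axis 2 1) * \<zeta> (axis 1 1)) * b x" for \<xi> \<zeta>
    unfolding contract_last_def b_def append_Cons append_Nil by (rule mvec_2_apply[OF alternating_bivector])
  have b: "\<pi> c x [coord_covector 1, coord_covector 2] = b x"
    by (simp add: b_def)
  show ?thesis
    using assms(2,3)
    by (simp add: cY c\<pi> b d_Pi_alpha_def d_Pi_def schouten_def on_charts_def
        wedge_1_1[unfolded One_nat_def]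
        wedge_0_2[OF alternating_partial_mvec[OF bivector_field assms(2,3)]]
        hamiltonian_field_apply Y dY d\<pi> coord_simps a_def algebra_simps)
qed

text \<open>The three terms are the components of \<open>f d\<phi>\<close>, of df wedge \<phi>, and
  of f d\<alpha> wedge \<phi>.\<close>

lemma d_f_theta_1:
  assumes "smooth_field A 1 \<phi>" "c \<in> A" "x \<in> chart_image c" "(\<lambda>y. f c y []) differentiable at x"
  defines "\<psi> \<equiv> \<lambda>i y. \<phi> c y [axis i 1]" and "f' \<equiv> \<lambda>i. pd i (\<lambda>y. f c y []) x"
    and "a \<equiv> \<lambda>i. pd i (\<alpha> \<circ> chart_inv c) x"
  shows "d_f_theta A f \<theta> 1 \<phi> c x [v, w] = (v $ 1 * w $ 2 - v $ 2 * w $ 1) *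
    (f c x [] * (pd 1 (\<psi> 2) x - pd 2 (\<psi> 1) x) - (f' 1 * \<psi> 2 x - f' 2 * \<psi> 1 x) -
     f c x [] * (a 1 * \<psi> 2 x - a 2 * \<psi> 1 x))"
proof -
  have \<phi>: "\<phi> c x [v] = v $ 1 * \<psi> 1 x + v $ 2 * \<psi> 2 x" for v
    unfolding \<psi>_def by (rule field_1_apply[OF smooth_field_alternating[OF assms(1)]])
  have "frechet_derivative (\<lambda>y. \<phi> c y [v]) (at x) h =
      v $ 1 * frechet_derivative (\<psi> 1) (at x) h + v $ 2 * frechet_derivative (\<psi> 2) (at x) h" for v h
    using field_1_apply[OF alternating_form_frechet_derivative[OF smooth_field_alternating[OF assms(1)]
      smooth_field_differentiable[OF assms(1-3)]]]
    unfolding \<psi>_def .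
  moreover have diff: "\<psi> i differentiable at x" for i
    unfolding \<psi>_def by (rule smooth_field_differentiable[OF assms(1-3)])
  ultimately have d\<phi>: "frechet_derivative (\<lambda>y. \<phi> c y [v]) (at x) h =
      v $ 1 * (h $ 1 * pd 1 (\<psi> 1) x + h $ 2 * pd 2 (\<psi> 1) x) +
      v $ 2 * (h $ 1 * pd 1 (\<psi> 2) x + h $ 2 * pd 2 (\<psi> 2) x)" for v h
    by (simp add: frechet_derivative_pd[OF diff, of _ h])
  show ?thesis
    using assms(2,3)
    by (simp add: d_f_theta_def d_f_def on_charts_def ext_deriv_1[unfolded One_nat_def]
      ext_deriv_0[where \<phi> = f] theta_eq wedge_1_1[unfolded One_nat_def] \<phi> d\<phi>
      frechet_derivative_pd[OF twist_differentiable[OF assms(2,3)], of v]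
      frechet_derivative_pd[OF twist_differentiable[OF assms(2,3)], of w]
      frechet_derivative_pd[OF assms(4), of v] frechet_derivative_pd[OF assms(4), of w]
      f'_def a_def algebra_simps)
qed

text \<open>Each of the three kinds of terms is separately the wedge product of a vector and a
  bivector on a plane.\<close>

lemma d_Pi_alpha_2:
  assumes "smooth_field A 2 P"
  shows "d_Pi_alpha A \<pi> \<alpha> 2 P = 0"
proof (intro ext)
  fix c x \<xi>s
  show "d_Pi_alpha A \<pi> \<alpha> 2 P c x \<xi>s = 0 c x \<xi>s"
  proof (cases "c \<in> A \<and> x \<in> chart_image c")
    case True
    then have c: "c \<in> A" "x \<in> chart_image c" by auto
    note eq_zero = wedge_1_2_plane_eq_zero[OF spans_plane_coord_covector]
    have "wedge 1 2 (contract_last (P c x) \<eta>) (partial_mvec i \<pi> c x) = 0" for i \<eta>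
      by (intro eq_zero alternating_form_contract alternating_partial_mvec[OF bivector_field c]
          smooth_field_alternating[OF assms])
    moreover have "wedge 1 2 (contract_last (\<pi> c x) \<eta>) (partial_mvec i P c x) = 0" for i \<eta>
      by (intro eq_zero alternating_form_contract alternating_partial_mvec[OF assms c] alternating_bivector)
    moreover have "wedge 1 2 (hamiltonian_field A \<pi> \<alpha> c x) (P c x) = 0"
      unfolding hamiltonian_field_eq[OF c]
      by (intro eq_zero alternating_form_contract alternating_bivector smooth_field_alternating[OF assms])
    ultimately show ?thesis
      using c by (simp add: d_Pi_alpha_def d_Pi_def schouten_def on_charts_def)
  qed (auto simp: d_Pi_alpha_def on_charts_def)
qed

text \<open>In components the value is a combination of the partial derivatives of one coefficient,
  with coefficients that cancel for any three vectors of the plane.\<close>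

lemma ext_deriv_2_eq_zero:
  assumes "smooth_field A 2 \<phi>"
  shows "ext_deriv A 2 \<phi> = 0"
proof (intro ext)
  fix c x vs
  show "ext_deriv A 2 \<phi> c x vs = 0 c x vs"
  proof (cases "c \<in> A \<and> x \<in> chart_image c \<and> length vs = 3")
    case True
    then have c: "c \<in> A" "x \<in> chart_image c" by auto
    obtain u v w where vs: "vs = [u, v, w]"
      using True by (auto simp: length_Suc_conv numeral_3_eq_3)
    let ?\<psi> = "\<lambda>y. \<phi> c y [axis 1 1, axis 2 1]"
    have *: "frechet_derivative (\<lambda>y. \<phi> c y [v, w]) (at x) h =
        (v $ 1 * w $ 2 - v $ 2 * w $ 1) * frechet_derivative ?\<psi> (at x) h" for v w h
      using field_2_apply[OF alternating_form_frechet_derivative[OF smooth_field_alternating[OF assms]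
        smooth_field_differentiable[OF assms c]]] .
    show ?thesis
      unfolding vs ext_deriv_2[OF c] *[of u v] *[of v w] *[of u w]
      by (simp add: frechet_derivative_pd[OF smooth_field_differentiable[OF assms c], of _ u]
          frechet_derivative_pd[OF smooth_field_differentiable[OF assms c], of _ v]
          frechet_derivative_pd[OF smooth_field_differentiable[OF assms c], of _ w] algebra_simps)
  qed (auto simp: ext_deriv_def on_charts_def)
qed

lemma d_f_theta_2:
  assumes "smooth_field A 2 \<phi>"
  shows "d_f_theta A f \<theta> 2 \<phi> = 0"
proof (intro ext)
  fix c x vs
  show "d_f_theta A f \<theta> 2 \<phi> c x vs = 0 c x vs"
  proof (cases "c \<in> A \<and> x \<in> chart_image c")
    case True
    then have c: "c \<in> A" "x \<in> chart_image c" by auto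
    note eq_zero = wedge_1_2_plane_eq_zero[OF spans_plane_axis _ smooth_field_alternating[OF assms]]
    have "(\<lambda>y. f c y []) differentiable at x"
      using f_has_derivative[OF c] by (auto simp: differentiable_def)
    then have "wedge 1 2 (ext_deriv A 0 f c x) (\<phi> c x) = 0"
      unfolding ext_deriv_0[OF c] by (intro eq_zero alternating_form_of_linear linear_frechet_derivative)
    moreover have "wedge 1 2 (\<theta> c x) (\<phi> c x) = 0"
      unfolding theta_eq[OF c]
      by (intro eq_zero alternating_form_of_linear linear_frechet_derivative twist_differentiable[OF c])
    ultimately show ?thesis
      using c by (simp add: d_f_theta_def d_f_def on_charts_def ext_deriv_2_eq_zero[OF assms])
  qed (auto simp: d_f_theta_def on_charts_def)
qed

text \<open>Together with \<open>d_f_theta_zero\<close> this settles degrees at least 3, where every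
  multivector field is 0.\<close>

lemma d_Pi_alpha_zero: "d_Pi_alpha A \<pi> \<alpha> p 0 = 0"
proof -
  have "contract_last 0 \<eta> = 0" "partial_mvec i 0 c x = 0" for i and \<eta> :: "(real^2) \<Rightarrow>\<^sub>L real"
      and c :: "('m, 2) chart" and x
    by (auto simp: contract_last_def partial_mvec_def fun_eq_iff)
  then show ?thesis
    by (intro ext) (simp add: d_Pi_alpha_def d_Pi_def schouten_def on_charts_def wedge_zero)
qed

lemma d_f_theta_zero: "d_f_theta A f \<theta> p 0 = 0"
  by (intro ext) (simp add: d_f_theta_def d_f_def ext_deriv_def on_charts_def wedge_zero)

section \<open>Lowering is a chain map\<close>

lemma d_f_theta_lower:
  assumes "P \<in> MVecs A p"
  shows "d_f_theta A f \<theta> p (lower \<nu> P) = lower \<nu> (d_Pi_alpha A \<pi> \<alpha> p P)"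
proof -
  have P: "smooth_field A p P"
    using assms by (simp add: MVecs_def)
  have LP: "smooth_field A p (lower \<nu> P)"
    using lower_Forms[OF assms] by (simp add: Forms_def)
  note L0 = linear_0[OF linear_lower, of \<nu>]
  \<comment> \<open>Off the chart images, and on lists of length other than \<open>p + 1\<close>,
    both sides are 0.\<close>
  have ext_eq: ?thesis if eq: "\<And>c x vs. c \<in> A \<Longrightarrow> x \<in> chart_image c \<Longrightarrow> length vs = Suc p \<Longrightarrow>
    d_f_theta A f \<theta> p (lower \<nu> P) c x vs = lower \<nu> (d_Pi_alpha A \<pi> \<alpha> p P) c x vs"
  proof (intro ext)
    fix c x vs
    show "d_f_theta A f \<theta> p (lower \<nu> P) c x vs = lower \<nu> (d_Pi_alpha A \<pi> \<alpha> p P) c x vs"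
    proof (cases "length vs = Suc p")
      case True
      have "d_f_theta A f \<theta> p (lower \<nu> P) c x = 0" "d_Pi_alpha A \<pi> \<alpha> p P c x = 0"
        if "\<not> (c \<in> A \<and> x \<in> chart_image c)"
        unfolding d_f_theta_def d_Pi_alpha_def on_charts_def if_not_P[OF that] by (rule refl)+
      then show ?thesis
        using eq True by (metis lower_def zero_fun_apply)
    next
      case False
      then show ?thesis
        using d_Pi_alpha_length[OF _ P, of "map (flat \<nu> c x) vs"] by (simp add: d_f_theta_length lower_def)
    qed
  qed
  consider "p = 0" | "p = 1" | "p = 2" | "p \<ge> 3" by linarith
  then show ?thesis
  proof cases
    case 1
    show ?thesis
    proof (rule ext_eq)
      fix c x and vs :: "(real^2) list"
      assume c: "c \<in> A" "x \<in> chart_image c" and "length vs = Suc p"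
      then obtain v where vs: "vs = [v]"
        using 1 by (auto simp: length_Suc_conv)
      have [simp]: "lower \<nu> P c y [] = P c y []" for y
        by (simp add: lower_def)
      show "d_f_theta A f \<theta> p (lower \<nu> P) c x vs = lower \<nu> (d_Pi_alpha A \<pi> \<alpha> p P) c x vs"
        using d_f_theta_0[OF LP[unfolded 1] c, of v] d_Pi_alpha_0[OF P[unfolded 1] c, of "flat \<nu> c x v"]
        unfolding 1 vs by (simp add: f_apply[OF c] flat_axis lower_def[of _ "d_Pi_alpha _ _ _ _ _"] algebra_simps)
    qed
  next
    case 2
    show ?thesis
    proof (rule ext_eq)
      fix c x and vs :: "(real^2) list"
      assume c: "c \<in> A" "x \<in> chart_image c" and "length vs = Suc p"
      then obtain v w where vs: "vs = [v, w]"
        using 2 by (auto simp: length_Suc_conv)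
      define b where "b = (\<lambda>y. \<pi> c y [coord_covector 1, coord_covector 2])"
      define n where "n = (\<lambda>y. \<nu> c y [axis 1 1, axis 2 1])"
      define Z where "Z = (\<lambda>i y. P c y [coord_covector i])"
      have Z: "(\<lambda>y. P c y [coord_covector i]) = Z i" for i
        by (simp add: Z_def)
      have at_x: "\<pi> c x [coord_covector 1, coord_covector 2] = b x" "\<nu> c x [axis 1 1, axis 2 1] = n x"
        "P c x [coord_covector i] = Z i x" for i
        by (simp_all add: b_def n_def Z_def)
      have diff: "n differentiable at x" "Z i differentiable at x" for i
        unfolding n_def Z_def
        using smooth_field_differentiable[OF _ c] volume_field P by blast+
      have f': "pd i (\<lambda>y. f c y []) x = b x * pd i n x + pd i b x * n x" for i
        using fun_cong[OF frechet_derivative_at[OF f_has_derivative[OF c]], of "axis i 1"]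
        by (simp add: b_def n_def)
      \<comment> \<open>\<open>flat\<close> sends the first basis vector to
        \<open>n dx\<^sub>2\<close> and the second to \<open>- n dx\<^sub>1\<close>, hence the
        exchange of components and the sign. The factor \<open>- 1\<close> is kept explicit so that
        \<open>d\<psi>'\<close> matches after unfolding.\<close>
      have \<psi>: "lower \<nu> P c y [axis 1 1] = n y * Z 2 y"
        "lower \<nu> P c y [axis 2 1] = (- 1) * (n y * Z 1 y)" for y
        unfolding lower_def list.map
          mvec_1_apply[OF smooth_field_alternating[OF P[unfolded 2]], of _ _ "flat \<nu> _ _ _"]
        by (simp_all add: flat_axis axis2_nth n_def Z_def)
      have d\<psi>: "pd i (\<lambda>y. n y * Z j y) x = n x * pd i (Z j) x + pd i n x * Z j x" for i j
        using fun_cong[OF frechet_derivative_at[OF has_derivative_mult_real[OF diff(1) diff(2)[of j]]], of "axis i 1"]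
        by simp
      have d\<psi>': "pd i (\<lambda>y. (- 1) * (n y * Z j y)) x = - (n x * pd i (Z j) x + pd i n x * Z j x)" for i j
        using fun_cong[OF frechet_derivative_at[OF has_derivative_mult_right[of _ _ _ "- 1",
            OF has_derivative_mult_real[OF diff(1) diff(2)[of j]]]], of "axis i 1"]
        by simp
      have "(\<lambda>y. f c y []) differentiable at x"
        using f_has_derivative[OF c] by (auto simp: differentiable_def)
      note d_f_theta_1 = d_f_theta_1[OF LP[unfolded 2] c this]
      \<comment> \<open>Since \<open>f = b n\<close> on the chart, the derivatives of
        \<open>n\<close> coming from the lowered field cancel those coming from
        \<open>df\<close>.\<close>
      have "d_f_theta A f \<theta> 1 (lower \<nu> P) c x [v, w] = (v $ 1 * w $ 2 - v $ 2 * w $ 1) * (n x)\<^sup>2 *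
        (Z 1 x * pd 1 b x + Z 2 x * pd 2 b x - b x * (pd 1 (Z 1) x + pd 2 (Z 2) x) +
         b x * (Z 1 x * pd 1 (\<alpha> \<circ> chart_inv c) x + Z 2 x * pd 2 (\<alpha> \<circ> chart_inv c) x))"
        unfolding d_f_theta_1 \<psi> f' d\<psi> d\<psi>'
        unfolding f_apply[OF c] at_x
        by (simp add: algebra_simps power2_eq_square)
      \<comment> \<open>The factor \<open>(n x)\<^sup>2\<close> is the determinant of
        \<open>flat\<close> between the standard basis and its dual basis.\<close>
      moreover have "lower \<nu> (d_Pi_alpha A \<pi> \<alpha> 1 P) c x [v, w] = (v $ 1 * w $ 2 - v $ 2 * w $ 1) * (n x)\<^sup>2 *
        (Z 1 x * pd 1 b x + Z 2 x * pd 2 b x - b x * (pd 1 (Z 1) x + pd 2 (Z 2) x) +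
         b x * (Z 1 x * pd 1 (\<alpha> \<circ> chart_inv c) x + Z 2 x * pd 2 (\<alpha> \<circ> chart_inv c) x))"
        unfolding lower_def list.map d_Pi_alpha_1[OF P[unfolded 2] c] flat_axis
          b_def[symmetric] n_def[symmetric] Z at_x
        by (simp add: algebra_simps power2_eq_square)
      ultimately show "d_f_theta A f \<theta> p (lower \<nu> P) c x vs = lower \<nu> (d_Pi_alpha A \<pi> \<alpha> p P) c x vs"
        by (simp add: 2 vs)
    qed
  next
    case 3
    then show ?thesis
      using P LP by (simp add: d_f_theta_2 d_Pi_alpha_2 L0)
  next
    case 4
    then have "P = 0"
      using smooth_field_plane_eq_zero[OF spans_plane_coord_covector P] by blast
    then show ?thesis
      by (simp add: L0 d_f_theta_zero d_Pi_alpha_zero)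
  qed
qed

lemma cohomology_isomorphic_surface:
  "cohomology_isomorphic (MVecs A) (d_Pi_alpha A \<pi> \<alpha>) (Forms A) (d_f_theta A f \<theta>)"
proof (rule cohomology_isomorphic_image[OF linear_lower subspace_supported inj_on_lower
      MVecs_supported _ Forms_eq_lower])
  show "d_Pi_alpha A \<pi> \<alpha> p P \<in> supported" for p P
    by (auto simp: supported_def d_Pi_alpha_def on_charts_def)
qed (rule d_f_theta_lower)

end

theorem proposition2p1:
  fixes X :: "'m topology"
    and A :: "('m, 2) chart set"
    and \<pi> :: "('m, 2) mvec"
    and \<alpha> :: "'m \<Rightarrow> real"
    and \<nu> f \<theta> :: "('m, 2) form"
  assumes "oriented_manifold X A"
    and "poisson_structure A \<pi>"
    and "smooth_function A \<alpha>"
    and "volume_form A \<nu>"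
    and "f = bivector_contract A \<pi> \<nu>"
    and "\<theta> = ext_deriv A 0 (scalar_field A \<alpha>)"
  shows "cohomology_isomorphic (MVecs A) (d_Pi_alpha A \<pi> \<alpha>) (Forms A) (d_f_theta A f \<theta>)"
proof -
  interpret poisson_surface X A \<nu> \<pi> \<alpha>
    using assms(1-4) by unfold_locales
  show ?thesis
    unfolding assms(5,6) by (rule cohomology_isomorphic_surface)
qed

end
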